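(* Let $M_\phi=G/H_\phi$ be the compact hermitian symmetric space associated with a non compact simple root $\phi$, let $\mu(gH_\phi)=g\rho_\phi g^{-1}$, and let $\nabla_{N_\phi}$ be the operator built from the flat contravariant connection of the Bruhat-Poisson structure and from the Kirillov-Konstant-Souriau form. Write $g=(\sigma_+,\sigma_-)$ for the tautological matrix-valued function on $G$, whose rows are sections of the trivial bundle $\mathcal E_+\oplus\mathcal E_-$. Then $$\nabla_{N_\phi}(g)=\big(-J(d\mu)+[\mu,d\mu]\big)\,g .$$ Moreover, in the cases AIII ($M_\phi=SU(n)/S(U(k)\times U(n-k))$), CI ($M_\phi=Sp(n)/U(n)$) and DIII ($M_\phi=SO(2n)/U(n)$), this formula implies for $\mathcal E_\pm$ $$\nabla_{N_\phi}(\sigma_\pm)=\mp\, C_\pm(d\mu)\,\sigma_\pm .$$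
   Context: **Setting.** Let $\mathfrak g$ be the compact form of a complex simple Lie algebra $\mathfrak g_{\mathbb C}$ of classical type, realized as a matrix algebra with $\mathfrak g=\{X\in\mathfrak g_{\mathbb C}: X^\dagger=-X\}$ (fundamental representation on $\mathbb C^N$), and let $G\subset M_N(\mathbb C)$ be the corresponding compact connected matrix group. Fix a Cartan subalgebra $\mathfrak t\subset\mathfrak g$, roots $\Phi$, positive/negative roots $\Phi^\pm$, and root spaces $\mathfrak g_\alpha\subset\mathfrak g_{\mathbb C}$. Let $\phi$ be a non compact simple root: in every positive root, $\phi$ appears with coefficient $0$ (compact type, $\Phi_c^+$) or $1$ (non compact type, $\Phi^+_{nc}$). Put $\mathfrak h_\phi=\mathfrak t\oplus\bigoplus_{\alpha\in\Phi_c^+}(\mathfrak g_\alpha\oplus\mathfrak g_{-\alpha})\cap\mathfrak g$, with connected subgroup $H_\phi\subset G$; its center is one dimensional and $\rho_\phi\in Z(\mathfrak h_\phi)$ is normalized by $\phi(\rho_\phi)=i$. Identify $\mathfrak g^*\cong\mathfrak g$ by the trace form. $M_\phi=G/H_\phi$ is the adjoint orbit of $\rho_\phi$ through $\mu(gH_\phi)=g\rho_\phi g^{-1}$; for $X\in\mathfrak g$ put $\mu(X)={\rm Tr}(\mu X)$. The KKS Poisson bivector $\Omega_{kks}^{-1}$ is determined by $\{\mu(X),\mu(Y)\}_{kks}=\mu([X,Y])$. A bivector $\pi$ is viewed as a map $T^*M\to TM$ by $\langle\pi(\alpha),\beta\rangle=\langle\pi,\alpha\wedge\beta\rangle$, $\{f,g\}=\langle\pi,df\wedge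 dg\rangle$, and $\Omega_{kks}:TM_\phi\to T^*M_\phi$ is the inverse of the map $\Omega_{kks}^{-1}$. **The maps $J$, $C_\pm$.** $J:\mathfrak g_{\mathbb C}\to\mathfrak g_{\mathbb C}$ is the linear map with $J|_{\mathfrak t}=0$, $J(E_\alpha)=\pm iE_\alpha$ for $E_\alpha\in\mathfrak g_\alpha$, $\alpha\in\Phi^\pm$; $C_\pm=i\pm J$; $\mathfrak b_\pm=C_\pm(\mathfrak g)$. These maps are applied to $\mathfrak g$-valued one-forms such as $d\mu$ in the obvious way. **Bruhat-Poisson structure.** $\mathfrak g_{\mathbb C}=\mathfrak g\oplus\mathfrak b_-$ with projections ${\rm pr}_{\mathfrak g,-}$, ${\rm pr}_{\mathfrak b_-}$, and $\langle A,B\rangle={\rm Im}\,{\rm Tr}(AB)$. The standard Poisson-Lie structure $\pi_G$ on $G$ is, for $\xi,\eta\in\mathfrak g\cong\mathfrak g^*$, $$\langle r_{g^{-1}}\pi_G(g),\xi\wedge\eta\rangle=\langle {\rm pr}_{\mathfrak g,-}({\rm Ad}_{g^{-1}}C_-(\xi)),\,{\rm pr}_{\mathfrak b_-}({\rm Ad}_{g^{-1}}C_-(\eta))\rangle ,$$ where $r_{g^{-1}}$ is right translation to the identity. $\pi_0$ is the unique Poisson structure on $M_\phi$ making $(G,\pi_G)\to (M_\phi,\pi_0)$ a Poisson map. **Bundles and connection.** The matrix $K_\phi=e^{\pi\rho_\phi}$ satisfies $K_\phi^2=e^{2ik_\phi}1$ for some real $k_\phi$, so $\mathbb C^N=V_+\oplus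 V_-$, the eigenspaces of $K_\phi$ with eigenvalues $\pm e^{ik_\phi}$; in the cases AIII, CI, DIII the labels are chosen so that $\rho_\phi$ acts on $V_\pm$ by a scalar $r^\pm$ with $r^+-r^-=i$. Let $R_\pm$ be the representation of $H_\phi$ on $V_\pm$ and $\mathcal E_\pm$ the vector bundle over $M_\phi$ associated with $G\to G/H_\phi$ and $R_\pm$. In a unitary basis adapted to $V_+\oplus V_-$ write $g=(\sigma_+(g),\sigma_-(g))$ with $\sigma_\pm(g)\in M_{N,n_\pm}(\mathbb C)$, $n_\pm=\dim V_\pm$. Sections of $\mathcal E_\pm$ are identified with row-vector valued functions $\sigma$ on $G$ with $\sigma(gh)=\sigma(g)R_\pm(h)$, $h\in H_\phi$. Each row of $\sigma_\pm$ is a section of $\mathcal E_\pm$ and each row of $g$ is a section of $\mathcal E_+\oplus\mathcal E_-$; the formulas are understood row by row. For $f\in C^\infty(M_\phi)\subset C^\infty(G)$ and a section $\sigma$, the contravariant connection is $\nabla_{df}(\sigma)=-\{f,\sigma\}_G$ (bracket of $\pi_G$, componentwise), i.e. $\nabla\sigma$ is the $\mathcal E$-valued vector field with $\langle df,\nabla\sigma\rangle=-\{f,\sigma\}_G$; and $\nabla_{N_\phi}=\Omega_{kks}\circ\nabla$, which takes values in $\mathcal E$-valued one-forms. *)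

theory Defs
  imports "HOL-Analysis.Analysis"
begin

section \<open>Complex matrices\<close>

definition cscale :: "complex \<Rightarrow> complex^'n^'m \<Rightarrow> complex^'n^'m" (infixr \<open>*\<^sub>C\<close> 75) where
  "c *\<^sub>C A = (\<chi> i j. c * A $ i $ j)"

definition dagger :: "complex^'n^'m \<Rightarrow> complex^'m^'n" where
  "dagger A = (\<chi> i j. cnj (A $ j $ i))"

definition unitary :: "complex^'n^'m \<Rightarrow> bool" where
  "unitary U \<longleftrightarrow> dagger U ** U = mat 1 \<and> U ** dagger U = mat 1"

definition lie :: "complex^'n^'n \<Rightarrow> complex^'n^'n \<Rightarrow> complex^'n^'n" where
  "lie X Y = X ** Y - Y ** X"

definition mexp :: "complex^'n^'n \<Rightarrow> complex^'n^'n" where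
  "mexp A = (\<Sum>k. (1 / fact k) *\<^sub>R (((**) A) ^^ k) (mat 1))"

text \<open>The trace form. It is real on skew-hermitian matrices, the only place where it is used, so
  taking the real part merely changes the type.\<close>

definition trform :: "complex^'n^'n \<Rightarrow> complex^'n^'n \<Rightarrow> real" where
  "trform X Y = Re (trace (X ** Y))"

text \<open>The connected matrix group with Lie algebra \<open>k\<close>. It is closed under inverses because
  \<open>mexp (- X)\<close> is inverse to \<open>mexp X\<close>.\<close>

inductive_set conn_group :: "(complex^'n^'n) set \<Rightarrow> (complex^'n^'n) set"
  for k :: "(complex^'n^'n) set" where
  one: "mat 1 \<in> conn_group k"
| step: "X \<in> k \<Longrightarrow> g \<in> conn_group k \<Longrightarrow> mexp X ** g \<in> conn_group k"


section \<open>Classical simple Lie algebras and their compact forms\<close>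

definition sl_algebra :: "(complex^'n^'n) set" where
  "sl_algebra = {X. trace X = 0}"

definition form_algebra :: "complex^'n^'n \<Rightarrow> (complex^'n^'n) set" where
  "form_algebra S = {X. transpose X ** S + S ** X = 0}"

text \<open>A unitary Gram matrix \<open>S\<close> makes the orthogonal or symplectic algebra stable under \<open>dagger\<close>, so
  that its skew-hermitian part is a compact form. Every position of the invariant bilinear form
  relative to the hermitian structure with this property is allowed.\<close>

definition classical :: "(complex^'n^'n) set \<Rightarrow> bool" where
  "classical gC \<longleftrightarrow> gC = sl_algebra \<or>
     (\<exists>S. unitary S \<and> transpose S = S \<and> gC = form_algebra S) \<or>
     (\<exists>S. unitary S \<and> transpose S = - S \<and> gC = form_algebra S)"

definition csubspace :: "(complex^'n^'n) set \<Rightarrow> bool" where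
  "csubspace I \<longleftrightarrow> 0 \<in> I \<and> (\<forall>X\<in>I. \<forall>Y\<in>I. X + Y \<in> I) \<and> (\<forall>c. \<forall>X\<in>I. c *\<^sub>C X \<in> I)"

definition lie_simple :: "(complex^'n^'n) set \<Rightarrow> bool" where
  "lie_simple gC \<longleftrightarrow> (\<exists>X\<in>gC. \<exists>Y\<in>gC. lie X Y \<noteq> 0) \<and>
     (\<forall>I. I \<subseteq> gC \<and> csubspace I \<and> (\<forall>X\<in>gC. \<forall>Y\<in>I. lie X Y \<in> I) \<longrightarrow> I = {0} \<or> I = gC)"

definition compact_form :: "(complex^'n^'n) set \<Rightarrow> (complex^'n^'n) set" where
  "compact_form gC = {X \<in> gC. dagger X = - X}"

definition cartan_subalgebra :: "(complex^'n^'n) set \<Rightarrow> (complex^'n^'n) set \<Rightarrow> bool" where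
  "cartan_subalgebra \<gg> t \<longleftrightarrow> subspace t \<and> t \<subseteq> \<gg> \<and> (\<forall>X\<in>t. \<forall>Y\<in>t. lie X Y = 0) \<and>
     (\<forall>X\<in>\<gg>. (\<forall>H\<in>t. lie X H = 0) \<longrightarrow> X \<in> t)"


section \<open>Roots\<close>

definition root_space ::
  "(complex^'n^'n) set \<Rightarrow> (complex^'n^'n) set \<Rightarrow> (complex^'n^'n \<Rightarrow> complex) \<Rightarrow> (complex^'n^'n) set" where
  "root_space gC t \<alpha> = {E \<in> gC. \<forall>H\<in>t. lie H E = \<alpha> H *\<^sub>C E}"

text \<open>Roots are functionals on the real Cartan subalgebra \<open>t\<close> (hence imaginary valued). They are made
  into total functions by the value 0 outside \<open>t\<close>; linearity on \<open>t\<close> is automatic.\<close>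

definition roots ::
  "(complex^'n^'n) set \<Rightarrow> (complex^'n^'n) set \<Rightarrow> (complex^'n^'n \<Rightarrow> complex) set" where
  "roots gC t = {\<alpha>. (\<forall>X. X \<notin> t \<longrightarrow> \<alpha> X = 0) \<and> (\<exists>H\<in>t. \<alpha> H \<noteq> 0) \<and>
                     (\<exists>E\<in>root_space gC t \<alpha>. E \<noteq> 0)}"

definition nat_comb :: "('a \<Rightarrow> complex) set \<Rightarrow> (('a \<Rightarrow> complex) \<Rightarrow> nat) \<Rightarrow> 'a \<Rightarrow> complex" where
  "nat_comb \<Delta> c = (\<lambda>H. \<Sum>\<delta>\<in>\<Delta>. of_nat (c \<delta>) * \<delta> H)"

definition pos_roots :: "('a \<Rightarrow> complex) set \<Rightarrow> ('a \<Rightarrow> complex) set \<Rightarrow> ('a \<Rightarrow> complex) set" where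
  "pos_roots \<Phi> \<Delta> = {\<alpha> \<in> \<Phi>. \<exists>c. \<alpha> = nat_comb \<Delta> c}"

definition neg_roots :: "('a \<Rightarrow> complex) set \<Rightarrow> ('a \<Rightarrow> complex) set \<Rightarrow> ('a \<Rightarrow> complex) set" where
  "neg_roots \<Phi> \<Delta> = {\<alpha> \<in> \<Phi>. (\<lambda>H. - \<alpha> H) \<in> pos_roots \<Phi> \<Delta>}"

definition simple_system :: "('a \<Rightarrow> complex) set \<Rightarrow> ('a \<Rightarrow> complex) set \<Rightarrow> bool" where
  "simple_system \<Phi> \<Delta> \<longleftrightarrow> finite \<Delta> \<and> \<Delta> \<subseteq> \<Phi> \<and>
     (\<forall>c :: ('a \<Rightarrow> complex) \<Rightarrow> real.
        (\<forall>H. (\<Sum>\<delta>\<in>\<Delta>. of_real (c \<delta>) * \<delta> H) = 0) \<longrightarrow> (\<forall>\<delta>\<in>\<Delta>. c \<delta> = 0)) \<and>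
     \<Phi> = pos_roots \<Phi> \<Delta> \<union> neg_roots \<Phi> \<Delta>"

definition noncompact_simple_root ::
  "('a \<Rightarrow> complex) set \<Rightarrow> ('a \<Rightarrow> complex) set \<Rightarrow> ('a \<Rightarrow> complex) \<Rightarrow> bool" where
  "noncompact_simple_root \<Phi> \<Delta> \<phi> \<longleftrightarrow> \<phi> \<in> \<Delta> \<and>
     (\<forall>\<alpha>\<in>\<Phi>. \<forall>c. \<alpha> = nat_comb \<Delta> c \<longrightarrow> c \<phi> = 0 \<or> c \<phi> = 1)"

definition compact_pos_roots ::
  "('a \<Rightarrow> complex) set \<Rightarrow> ('a \<Rightarrow> complex) set \<Rightarrow> ('a \<Rightarrow> complex) \<Rightarrow> ('a \<Rightarrow> complex) set" where
  "compact_pos_roots \<Phi> \<Delta> \<phi> = {\<alpha> \<in> \<Phi>. \<exists>c. \<alpha> = nat_comb \<Delta> c \<and> c \<phi> = 0}"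

definition h_sub ::
  "(complex^'n^'n) set \<Rightarrow> (complex^'n^'n) set \<Rightarrow> (complex^'n^'n \<Rightarrow> complex) set \<Rightarrow>
   (complex^'n^'n \<Rightarrow> complex) \<Rightarrow> (complex^'n^'n) set" where
  "h_sub gC t \<Delta> \<phi> = span (t \<union>
     (\<Union>\<alpha>\<in>compact_pos_roots (roots gC t) \<Delta> \<phi>.
        {A + B | A B. A \<in> root_space gC t \<alpha> \<and> B \<in> root_space gC t (\<lambda>H. - \<alpha> H)} \<inter> compact_form gC))"

definition lie_center :: "(complex^'n^'n) set \<Rightarrow> (complex^'n^'n) set" where
  "lie_center k = {X \<in> k. \<forall>Y\<in>k. lie X Y = 0}"


section \<open>The maps J and C, and the Poisson-Lie structure of G\<close>

text \<open>These properties determine \<open>J\<close> uniquely on \<open>gC\<close>; its values elsewhere are irrelevant.\<close>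

definition is_J ::
  "(complex^'n^'n) set \<Rightarrow> (complex^'n^'n) set \<Rightarrow> (complex^'n^'n \<Rightarrow> complex) set \<Rightarrow>
   (complex^'n^'n \<Rightarrow> complex^'n^'n) \<Rightarrow> bool" where
  "is_J gC t \<Delta> J \<longleftrightarrow>
     (\<forall>X\<in>gC. J X \<in> gC) \<and>
     (\<forall>X\<in>gC. \<forall>Y\<in>gC. J (X + Y) = J X + J Y) \<and>
     (\<forall>c. \<forall>X\<in>gC. J (c *\<^sub>C X) = c *\<^sub>C J X) \<and>
     (\<forall>H\<in>t. J H = 0) \<and>
     (\<forall>\<alpha>\<in>pos_roots (roots gC t) \<Delta>. \<forall>E\<in>root_space gC t \<alpha>. J E = \<i> *\<^sub>C E) \<and>
     (\<forall>\<alpha>\<in>neg_roots (roots gC t) \<Delta>. \<forall>E\<in>root_space gC t \<alpha>. J E = (- \<i>) *\<^sub>C E)"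

definition C_plus :: "(complex^'n^'n \<Rightarrow> complex^'n^'n) \<Rightarrow> complex^'n^'n \<Rightarrow> complex^'n^'n" where
  "C_plus J X = \<i> *\<^sub>C X + J X"

definition C_minus :: "(complex^'n^'n \<Rightarrow> complex^'n^'n) \<Rightarrow> complex^'n^'n \<Rightarrow> complex^'n^'n" where
  "C_minus J X = \<i> *\<^sub>C X - J X"

definition b_minus ::
  "(complex^'n^'n \<Rightarrow> complex^'n^'n) \<Rightarrow> (complex^'n^'n) set \<Rightarrow> (complex^'n^'n) set" where
  "b_minus J \<gg> = C_minus J ` \<gg>"

definition pr_g ::
  "(complex^'n^'n \<Rightarrow> complex^'n^'n) \<Rightarrow> (complex^'n^'n) set \<Rightarrow> complex^'n^'n \<Rightarrow> complex^'n^'n" where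
  "pr_g J \<gg> A = (THE X. X \<in> \<gg> \<and> A - X \<in> b_minus J \<gg>)"

definition pr_b ::
  "(complex^'n^'n \<Rightarrow> complex^'n^'n) \<Rightarrow> (complex^'n^'n) set \<Rightarrow> complex^'n^'n \<Rightarrow> complex^'n^'n" where
  "pr_b J \<gg> A = (THE B. B \<in> b_minus J \<gg> \<and> A - B \<in> \<gg>)"

definition Ad :: "complex^'n^'n \<Rightarrow> complex^'n^'n \<Rightarrow> complex^'n^'n" where
  "Ad g X = g ** X ** matrix_inv g"

text \<open>The bivector of \<open>G\<close> at \<open>g\<close>, right translated to the identity.\<close>

definition pi_G ::
  "(complex^'n^'n \<Rightarrow> complex^'n^'n) \<Rightarrow> (complex^'n^'n) set \<Rightarrow> complex^'n^'n \<Rightarrow>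
   complex^'n^'n \<Rightarrow> complex^'n^'n \<Rightarrow> real" where
  "pi_G J \<gg> g \<xi> \<eta> =
     Im (trace (pr_g J \<gg> (Ad (matrix_inv g) (C_minus J \<xi>)) ** pr_b J \<gg> (Ad (matrix_inv g) (C_minus J \<eta>))))"

text \<open>Derivative of \<open>f\<close> at \<open>g\<close> along the tangent vector \<open>X ** g\<close> of the group.\<close>

definition group_deriv ::
  "complex^'n^'n \<Rightarrow> (complex^'n^'n \<Rightarrow> real) \<Rightarrow> complex^'n^'n \<Rightarrow> real" where
  "group_deriv X f g = vector_derivative (\<lambda>s::real. f (mexp (s *\<^sub>R X) ** g)) (at 0)"

text \<open>The differential of \<open>f\<close> at \<open>g\<close>, right translated to the identity, as an element of
  \<open>\<gg>\<close> by means of the trace form.\<close>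

definition group_diff ::
  "(complex^'n^'n) set \<Rightarrow> (complex^'n^'n \<Rightarrow> real) \<Rightarrow> complex^'n^'n \<Rightarrow> complex^'n^'n" where
  "group_diff \<gg> f g = (THE \<xi>. \<xi> \<in> \<gg> \<and> (\<forall>X\<in>\<gg>. trform \<xi> X = group_deriv X f g))"

definition bracket_G ::
  "(complex^'n^'n \<Rightarrow> complex^'n^'n) \<Rightarrow> (complex^'n^'n) set \<Rightarrow>
   (complex^'n^'n \<Rightarrow> real) \<Rightarrow> (complex^'n^'n \<Rightarrow> real) \<Rightarrow> complex^'n^'n \<Rightarrow> real" where
  "bracket_G J \<gg> f h g = pi_G J \<gg> g (group_diff \<gg> f g) (group_diff \<gg> h g)"


section \<open>Smooth functions\<close>

primrec Ck_on ::
  "nat \<Rightarrow> 'a::real_normed_vector set \<Rightarrow> ('a \<Rightarrow> 'b::real_normed_vector) \<Rightarrow> bool" where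
  "Ck_on 0 U f \<longleftrightarrow> continuous_on U f"
| "Ck_on (Suc k) U f \<longleftrightarrow> (\<forall>x\<in>U. f differentiable (at x)) \<and>
     (\<forall>v. Ck_on k U (\<lambda>x. frechet_derivative f (at x) v))"

text \<open>A smooth function on a compact submanifold \<open>M\<close> is the restriction of a function that is smooth
  near \<open>M\<close>.\<close>

definition smooth_near ::
  "'a::real_normed_vector set \<Rightarrow> ('a \<Rightarrow> 'b::real_normed_vector) \<Rightarrow> bool" where
  "smooth_near M f \<longleftrightarrow> (\<exists>U. open U \<and> M \<subseteq> U \<and> (\<forall>k. Ck_on k U f))"


section \<open>The adjoint orbit and its KKS structure\<close>

definition mu :: "complex^'n^'n \<Rightarrow> complex^'n^'n \<Rightarrow> complex^'n^'n" where
  "mu \<rho> g = g ** \<rho> ** matrix_inv g"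

text \<open>The homogeneous space is realized as the adjoint orbit \<open>mu \<rho> ` G\<close> inside \<open>\<gg>\<close>, with
  tangent spaces inside \<open>\<gg>\<close>.\<close>

definition orbit :: "(complex^'n^'n) set \<Rightarrow> complex^'n^'n \<Rightarrow> (complex^'n^'n) set" where
  "orbit \<gg> \<rho> = mu \<rho> ` conn_group \<gg>"

definition tang :: "(complex^'n^'n) set \<Rightarrow> complex^'n^'n \<Rightarrow> (complex^'n^'n) set" where
  "tang \<gg> x = (\<lambda>X. lie X x) ` \<gg>"

text \<open>The differential along the orbit of a function given near the orbit. Covectors are extended
  by 0 outside the tangent space, so that equality of covectors is equality of functions.\<close>

definition orbit_diff ::
  "(complex^'n^'n) set \<Rightarrow> (complex^'n^'n \<Rightarrow> 'b::real_normed_vector) \<Rightarrow>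
   complex^'n^'n \<Rightarrow> complex^'n^'n \<Rightarrow> 'b" where
  "orbit_diff \<gg> f x = (\<lambda>v. if v \<in> tang \<gg> x then frechet_derivative f (at x) v else 0)"

definition cotang :: "(complex^'n^'n) set \<Rightarrow> complex^'n^'n \<Rightarrow> (complex^'n^'n \<Rightarrow> real) set" where
  "cotang \<gg> x = {a. (\<forall>v\<in>tang \<gg> x. \<forall>w\<in>tang \<gg> x. a (v + w) = a v + a w) \<and>
                     (\<forall>c. \<forall>v\<in>tang \<gg> x. a (c *\<^sub>R v) = c * a v) \<and>
                     (\<forall>v. v \<notin> tang \<gg> x \<longrightarrow> a v = 0)}"

definition is_bivector ::
  "(complex^'n^'n) set \<Rightarrow> complex^'n^'n \<Rightarrow>
   ((complex^'n^'n \<Rightarrow> real) \<Rightarrow> (complex^'n^'n \<Rightarrow> real) \<Rightarrow> real) \<Rightarrow> bool" where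
  "is_bivector \<gg> x P \<longleftrightarrow>
     (\<forall>a\<in>cotang \<gg> x. \<forall>a'\<in>cotang \<gg> x. \<forall>b\<in>cotang \<gg> x. P (\<lambda>v. a v + a' v) b = P a b + P a' b) \<and>
     (\<forall>c. \<forall>a\<in>cotang \<gg> x. \<forall>b\<in>cotang \<gg> x. P (\<lambda>v. c * a v) b = c * P a b) \<and>
     (\<forall>a\<in>cotang \<gg> x. \<forall>b\<in>cotang \<gg> x. P a b = - P b a)"

definition is_kks ::
  "(complex^'n^'n) set \<Rightarrow> complex^'n^'n \<Rightarrow>
   (complex^'n^'n \<Rightarrow> (complex^'n^'n \<Rightarrow> real) \<Rightarrow> (complex^'n^'n \<Rightarrow> real) \<Rightarrow> real) \<Rightarrow> bool" where
  "is_kks \<gg> \<rho> P \<longleftrightarrow> (\<forall>x\<in>orbit \<gg> \<rho>. is_bivector \<gg> x (P x) \<and>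
     (\<forall>X\<in>\<gg>. \<forall>Y\<in>\<gg>.
        P x (orbit_diff \<gg> (\<lambda>y. trform y X) x) (orbit_diff \<gg> (\<lambda>y. trform y Y) x) = trform x (lie X Y)))"

definition sharp ::
  "(complex^'n^'n) set \<Rightarrow>
   (complex^'n^'n \<Rightarrow> (complex^'n^'n \<Rightarrow> real) \<Rightarrow> (complex^'n^'n \<Rightarrow> real) \<Rightarrow> real) \<Rightarrow>
   complex^'n^'n \<Rightarrow> (complex^'n^'n \<Rightarrow> real) \<Rightarrow> complex^'n^'n" where
  "sharp \<gg> P x a = (THE w. w \<in> tang \<gg> x \<and> (\<forall>b\<in>cotang \<gg> x. b w = P x a b))"

definition Omega ::
  "(complex^'n^'n) set \<Rightarrow>
   (complex^'n^'n \<Rightarrow> (complex^'n^'n \<Rightarrow> real) \<Rightarrow> (complex^'n^'n \<Rightarrow> real) \<Rightarrow> real) \<Rightarrow>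
   complex^'n^'n \<Rightarrow> complex^'n^'n \<Rightarrow> complex^'n^'n \<Rightarrow> real" where
  "Omega \<gg> P x w = (THE a. a \<in> cotang \<gg> x \<and> sharp \<gg> P x a = w)"


section \<open>The homogeneous bundles and the operator\<close>

text \<open>Sections of the bundle associated with a representation \<open>R\<close> of \<open>H\<close>, as equivariant functions
  on \<open>G\<close> with values in row vectors.\<close>

definition is_section ::
  "(complex^'n^'n) set \<Rightarrow> (complex^'n^'n) set \<Rightarrow> (complex^'n^'n \<Rightarrow> complex^'k^'k) \<Rightarrow>
   (complex^'n^'n \<Rightarrow> complex^'k) \<Rightarrow> bool" where
  "is_section G H R \<sigma> \<longleftrightarrow> (\<exists>F. smooth_near G F \<and> (\<forall>g\<in>G. \<sigma> g = F g)) \<and>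
     (\<forall>g\<in>G. \<forall>h\<in>H. \<sigma> (g ** h) = \<sigma> g v* R h)"

text \<open>The tangent vector at \<open>mu \<rho> g\<close> obtained by applying the contravariant connection to one
  real component \<open>s\<close> of a section: its pairing with \<open>df\<close> is minus the bracket of \<open>f\<close> and \<open>s\<close>.\<close>

definition nabla_comp ::
  "(complex^'n^'n \<Rightarrow> complex^'n^'n) \<Rightarrow> (complex^'n^'n) set \<Rightarrow> complex^'n^'n \<Rightarrow>
   (complex^'n^'n \<Rightarrow> real) \<Rightarrow> complex^'n^'n \<Rightarrow> complex^'n^'n" where
  "nabla_comp J \<gg> \<rho> s g = (THE w. w \<in> tang \<gg> (mu \<rho> g) \<and>
     (\<forall>f::complex^'n^'n \<Rightarrow> real. smooth_near (orbit \<gg> \<rho>) f \<longrightarrow>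
        orbit_diff \<gg> f (mu \<rho> g) w = - bracket_G J \<gg> (\<lambda>g'. f (mu \<rho> g')) s g))"

text \<open>Bundle-valued one-forms are described at \<open>g\<close> by their values, in the fibre coordinates given
  by \<open>g\<close>, on the tangent vectors at \<open>mu \<rho> g\<close>. Connection and KKS form act on real and imaginary
  parts of the components of a section.\<close>

definition nabla_N ::
  "(complex^'n^'n \<Rightarrow> complex^'n^'n) \<Rightarrow> (complex^'n^'n) set \<Rightarrow> complex^'n^'n \<Rightarrow>
   (complex^'n^'n \<Rightarrow> (complex^'n^'n \<Rightarrow> real) \<Rightarrow> (complex^'n^'n \<Rightarrow> real) \<Rightarrow> real) \<Rightarrow>
   (complex^'n^'n \<Rightarrow> complex^'k) \<Rightarrow> complex^'n^'n \<Rightarrow> complex^'n^'n \<Rightarrow> complex^'k" where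
  "nabla_N J \<gg> \<rho> P \<sigma> g v = (\<chi> j. Complex
     (Omega \<gg> P (mu \<rho> g) (nabla_comp J \<gg> \<rho> (\<lambda>g'. Re (\<sigma> g' $ j)) g) v)
     (Omega \<gg> P (mu \<rho> g) (nabla_comp J \<gg> \<rho> (\<lambda>g'. Im (\<sigma> g' $ j)) g) v))"

definition nabla_N_rows ::
  "(complex^'n^'n \<Rightarrow> complex^'n^'n) \<Rightarrow> (complex^'n^'n) set \<Rightarrow> complex^'n^'n \<Rightarrow>
   (complex^'n^'n \<Rightarrow> (complex^'n^'n \<Rightarrow> real) \<Rightarrow> (complex^'n^'n \<Rightarrow> real) \<Rightarrow> real) \<Rightarrow>
   (complex^'n^'n \<Rightarrow> complex^'k^'r) \<Rightarrow> complex^'n^'n \<Rightarrow> complex^'n^'n \<Rightarrow> complex^'k^'r" where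
  "nabla_N_rows J \<gg> \<rho> P F g v = (\<chi> i. nabla_N J \<gg> \<rho> P (\<lambda>g'. F g' $ i) g v)"

definition V_plus :: "complex^'n^'n \<Rightarrow> real \<Rightarrow> (complex^'n) set" where
  "V_plus \<rho> k = {v. mexp (pi *\<^sub>R \<rho>) *v v = cis k *s v}"

definition V_minus :: "complex^'n^'n \<Rightarrow> real \<Rightarrow> (complex^'n) set" where
  "V_minus \<rho> k = {v. mexp (pi *\<^sub>R \<rho>) *v v = (- cis k) *s v}"

text \<open>The columns of the unitary matrix \<open>U\<close> form a basis adapted to the decomposition; for
  dimension reasons those with index \<open>Inl j\<close> span \<open>V_plus\<close> and those with index \<open>Inr j\<close>
  span \<open>V_minus\<close>.\<close>

definition adapted_basis :: "complex^'n^'n \<Rightarrow> real \<Rightarrow> complex^('p::finite + 'm::finite)^'n \<Rightarrow> bool" where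
  "adapted_basis \<rho> k U \<longleftrightarrow> unitary U \<and>
     (\<forall>j. column (Inl j) U \<in> V_plus \<rho> k) \<and> (\<forall>j. column (Inr j) U \<in> V_minus \<rho> k)"

definition in_basis :: "complex^'q^'n \<Rightarrow> complex^'n^'n \<Rightarrow> complex^'q^'q" where
  "in_basis U A = dagger U ** A ** U"

definition sigma_plus :: "complex^('p::finite + 'm::finite)^'n \<Rightarrow> complex^'n^'n \<Rightarrow> complex^'p^('p + 'm)" where
  "sigma_plus U g = (\<chi> i j. in_basis U g $ i $ Inl j)"

definition sigma_minus :: "complex^('p::finite + 'm::finite)^'n \<Rightarrow> complex^'n^'n \<Rightarrow> complex^'m^('p + 'm)" where
  "sigma_minus U g = (\<chi> i j. in_basis U g $ i $ Inr j)"

definition R_plus :: "complex^('p::finite + 'm::finite)^'n \<Rightarrow> complex^'n^'n \<Rightarrow> complex^'p^'p" where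
  "R_plus U h = (\<chi> i j. in_basis U h $ Inl i $ Inl j)"

definition R_minus :: "complex^('p::finite + 'm::finite)^'n \<Rightarrow> complex^'n^'n \<Rightarrow> complex^'m^'m" where
  "R_minus U h = (\<chi> i j. in_basis U h $ Inr i $ Inr j)"


section \<open>The cases AIII, CI and DIII\<close>

definition stabilizer :: "(complex^'n^'n) set \<Rightarrow> (complex^'n) set \<Rightarrow> (complex^'n^'n) set" where
  "stabilizer G W = {g \<in> G. \<forall>w\<in>W. g *v w \<in> W}"

definition lagrangian :: "complex^'n^'n \<Rightarrow> (complex^'n) set \<Rightarrow> bool" where
  "lagrangian S L \<longleftrightarrow> L = {v. \<forall>w\<in>L. (\<Sum>i\<in>UNIV. v $ i * (S *v w) $ i) = 0}"

text \<open>In a special unitary group, the subgroups \<open>S(U(k) \<times> U(n-k))\<close> are the stabilizers of proper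
  nonzero subspaces. In the compact group of a symplectic or of an even orthogonal form, the
  subgroups \<open>U(n)\<close> are the stabilizers of lagrangian subspaces: such a stabilizer acts on
  \<open>L\<close> as the full unitary group of \<open>L\<close> and on its hermitian complement by the dual
  representation.\<close>

definition case_AIII :: "(complex^'n^'n) set \<Rightarrow> (complex^'n^'n) set \<Rightarrow> bool" where
  "case_AIII gC H \<longleftrightarrow> gC = sl_algebra \<and>
     (\<exists>W. vec.subspace W \<and> W \<noteq> {0} \<and> W \<noteq> UNIV \<and>
          H = stabilizer (conn_group (compact_form gC)) W)"

definition case_CI :: "(complex^'n^'n) set \<Rightarrow> (complex^'n^'n) set \<Rightarrow> bool" where
  "case_CI gC H \<longleftrightarrow> (\<exists>S L. unitary S \<and> transpose S = - S \<and> gC = form_algebra S \<and>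
     lagrangian S L \<and> H = stabilizer (conn_group (compact_form gC)) L)"

definition case_DIII :: "(complex^'n^'n) set \<Rightarrow> (complex^'n^'n) set \<Rightarrow> bool" where
  "case_DIII gC H \<longleftrightarrow> (\<exists>S L. unitary S \<and> transpose S = S \<and> gC = form_algebra S \<and>
     lagrangian S L \<and> H = stabilizer (conn_group (compact_form gC)) L)"

end

theory Submission
  imports Defs
begin

text \<open>Let \<open>J_g = Ad_g J Ad_g\<^sup>-\<^sup>1 - J\<close>. Since \<open>\<i> X = C_minus J X + J X\<close>, the two projections in \<open>\<pi>_G\<close>
  are explicit, and \<open>\<pi>_G(\<xi>, \<eta>) = Tr (J_g(\<xi>) \<eta>)\<close>. The pull-back of \<open>f\<close> along \<open>\<mu>\<close> has the right
  translated differential \<open>[\<mu>, df]\<close>, so the contravariant derivative of a function \<open>s\<close> is the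
  tangent vector \<open>[J_g(ds), \<mu>]\<close>, which the KKS form sends to the covector
  \<open>v \<mapsto> - Tr (v J_g(ds)) = Tr (J_g(v) ds)\<close>, because \<open>J\<close> is skew for the trace form. Finally,
  \<open>J ad_\<rho> = ad_\<rho>\<^sup>2\<close>: the eigenvalues of \<open>ad_\<rho>\<close> on the positive and negative root spaces are \<open>0\<close> or
  \<open>\<plusminus>\<i>\<close>. Hence \<open>J_g(v) = [\<mu>, v] - J v\<close> for \<open>v\<close> tangent to the orbit. When \<open>\<rho>\<close> has two eigenvalues
  with difference \<open>\<i>\<close>, \<open>[\<mu>, v]\<close> acts on the two eigenbundles as \<open>\<minusplus>\<i> v\<close>.\<close>

section \<open>Matrix algebra\<close>

text \<open>The root decomposition is not part of the data: \<open>roots\<close> only collects the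
  functionals that have an eigenvector. That \<open>t\<close>, its imaginary multiples and the root
  spaces span \<open>gC\<close> has to be derived, and it comes from stability under
  \<open>dagger\<close>, which makes \<open>lie H\<close> skew-adjoint for the real Hilbert-Schmidt
  product when \<open>H\<close> is in \<open>t\<close>. Every linear identity about \<open>J\<close>
  can then be tested on \<open>t\<close> and on root vectors.

  Gradients, projections, the contravariant derivative and the inverse of the KKS map are definite
  descriptions, so each formula needs existence and uniqueness. These rest on two facts: the trace
  form is negative definite on \<open>\<gg>\<close>, which gives Riesz representation on
  \<open>\<gg>\<close> and on its tangent subspaces, and \<open>\<gg>\<close> meets its imaginary
  multiple only in 0.

  The functions \<open>s\<close> to be differentiated are real and imaginary parts of matrix
  entries. They are linear, so the derivative along \<open>X ** g\<close> is
  \<open>s (X ** g)\<close>. The resulting covector is therefore again a value of \<open>s\<close>,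
  and reading it off for all entries gives a matrix formula.\<close>

lemma bounded_bilinear_matrix_mult:
  "bounded_bilinear ((**) :: complex^'n^'m \<Rightarrow> complex^'p^'n \<Rightarrow> complex^'p^'m)"
proof -
  have "bilinear ((**) :: complex^'n^'m \<Rightarrow> complex^'p^'n \<Rightarrow> complex^'p^'m)"
    unfolding bilinear_def linear_iff
    by (simp add: vec_eq_iff matrix_matrix_mult_def algebra_simps sum.distrib scaleR_sum_right)
  then show ?thesis
    by (simp add: bilinear_conv_bounded_bilinear)
qed

interpretation matrix_mult: bounded_bilinear "(**) :: complex^'n^'m \<Rightarrow> complex^'p^'n \<Rightarrow> complex^'p^'m"
  by (rule bounded_bilinear_matrix_mult)

lemmas matrix_mult_simps =
  matrix_mult.add_left matrix_mult.add_right matrix_mult.diff_left matrix_mult.diff_right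
  matrix_mult.minus_left matrix_mult.minus_right matrix_mult.scaleR_left matrix_mult.scaleR_right
  matrix_mult.zero_left matrix_mult.zero_right

lemma scaleR_conv_cscale: "r *\<^sub>R A = of_real r *\<^sub>C A"
  unfolding cscale_def vec_eq_iff vector_scaleR_component scaleR_conv_of_real[of r "_ :: complex"]
  by simp

lemma cscale_left: "(c *\<^sub>C A) ** B = c *\<^sub>C (A ** B)"
  by (simp add: cscale_def vec_eq_iff matrix_matrix_mult_def sum_distrib_left mult_ac)

lemma cscale_right: "A ** (c *\<^sub>C B) = c *\<^sub>C (A ** B)"
  by (simp add: cscale_def vec_eq_iff matrix_matrix_mult_def sum_distrib_left mult_ac)

lemma cscale_cscale [simp]: "c *\<^sub>C d *\<^sub>C A = (c * d) *\<^sub>C A"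
  by (simp add: cscale_def vec_eq_iff mult_ac)

lemma cscale_one [simp]: "1 *\<^sub>C A = A"
  and cscale_zero_left [simp]: "0 *\<^sub>C A = 0"
  and cscale_zero_right [simp]: "c *\<^sub>C 0 = 0"
  and cscale_minus_left: "(- c) *\<^sub>C A = - (c *\<^sub>C A)"
  and cscale_minus_right: "c *\<^sub>C (- A) = - (c *\<^sub>C A)"
  and cscale_add_right: "c *\<^sub>C (A + B) = c *\<^sub>C A + c *\<^sub>C B"
  and cscale_diff_right: "c *\<^sub>C (A - B) = c *\<^sub>C A - c *\<^sub>C B"
  and cscale_add_left: "(c + d) *\<^sub>C A = c *\<^sub>C A + d *\<^sub>C A"
  by (simp_all add: cscale_def vec_eq_iff algebra_simps)

lemma cscale_eq_0_iff [simp]: "c *\<^sub>C A = 0 \<longleftrightarrow> c = 0 \<or> A = 0"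
  by (auto simp: cscale_def vec_eq_iff)

lemma trace_cscale: "trace (c *\<^sub>C A) = c * trace A"
  by (simp add: trace_def cscale_def sum_distrib_left)

lemma trace_minus: "trace (- A :: complex^'n^'n) = - trace A"
  by (simp add: trace_def sum_negf)

lemma trace_zero [simp]: "trace (0 :: complex^'n^'n) = 0"
  by (simp add: trace_def)

lemma trace_dagger: "trace (dagger A) = cnj (trace A)"
  by (simp add: trace_def dagger_def)

lemma dagger_mult: "dagger (A ** B) = dagger B ** dagger A"
  by (simp add: dagger_def vec_eq_iff matrix_matrix_mult_def mult_ac)

lemma dagger_dagger [simp]: "dagger (dagger A) = A"
  and dagger_zero [simp]: "dagger 0 = 0"
  and dagger_mat_1 [simp]: "dagger (mat 1) = mat 1"
  and dagger_add: "dagger (A + B) = dagger A + dagger B"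
  and dagger_diff: "dagger (A - B) = dagger A - dagger B"
  and dagger_minus: "dagger (- A) = - dagger A"
  and dagger_cscale: "dagger (c *\<^sub>C A) = cnj c *\<^sub>C dagger A"
  by (auto simp add: dagger_def vec_eq_iff cscale_def mat_def)

lemmas dagger_simps = dagger_add dagger_diff dagger_minus dagger_cscale dagger_mult

lemma bounded_linear_dagger: "bounded_linear (dagger :: complex^'n^'m \<Rightarrow> _)"
  by (intro linear_conv_bounded_linear[THEN iffD1] linearI)
    (simp_all add: dagger_simps scaleR_conv_cscale)

lemma bounded_linear_transpose: "bounded_linear (transpose :: complex^'n^'m \<Rightarrow> _)"
  by (intro linear_conv_bounded_linear[THEN iffD1] linearI)
    (simp_all add: transpose_def vec_eq_iff)

text \<open>Identifies the Euclidean inner product of the matrix type as the real Hilbert-Schmidt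
  product, so that orthogonal complements and symmetric operators can be handled by traces.\<close>

lemma inner_matrix: "inner X Y = Re (trace (dagger X ** Y))"
  for X Y :: "complex^'n^'m"
proof -
  have "inner X Y = (\<Sum>i\<in>UNIV. \<Sum>j\<in>UNIV. Re (cnj (X $ i $ j) * Y $ i $ j))"
    by (simp add: inner_vec_def inner_complex_def)
  also have "\<dots> = (\<Sum>j\<in>UNIV. \<Sum>i\<in>UNIV. Re (cnj (X $ i $ j) * Y $ i $ j))"
    by (rule sum.swap)
  finally show ?thesis
    by (simp add: trace_def matrix_matrix_mult_def dagger_def)
qed

section \<open>The commutator and the invariance of the trace form\<close>

lemma lie_simps:
  "lie (X + Y) Z = lie X Z + lie Y Z" "lie Z (X + Y) = lie Z X + lie Z Y"
  "lie (X - Y) Z = lie X Z - lie Y Z" "lie Z (X - Y) = lie Z X - lie Z Y"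
  "lie (- X) Z = - lie X Z" "lie Z (- X) = - lie Z X"
  "lie (c *\<^sub>C X) Z = c *\<^sub>C lie X Z" "lie Z (c *\<^sub>C X) = c *\<^sub>C lie Z X"
  "lie (r *\<^sub>R X) Z = r *\<^sub>R lie X Z" "lie Z (r *\<^sub>R X) = r *\<^sub>R lie Z X"
  "lie 0 Z = 0" "lie Z 0 = 0"
  by (simp_all add: lie_def matrix_mult_simps cscale_left cscale_right cscale_diff_right
      scaleR_diff_right)

lemma lie_anticomm: "lie Y X = - lie X Y"
  by (simp add: lie_def)

lemma lie_jacobi: "lie X (lie Y Z) = lie (lie X Y) Z + lie Y (lie X Z)"
  by (simp add: lie_def matrix_mult_simps matrix_mul_assoc)

lemma dagger_lie: "dagger (lie X Y) = - lie (dagger X) (dagger Y)"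
  by (simp add: lie_def dagger_simps)

lemma trace_lie: "trace (lie X Y ** Z) = trace (X ** lie Y Z)"
proof -
  have "trace (Y ** X ** Z) = trace (X ** Z ** Y)"
    using trace_mul_sym[of Y "X ** Z"] by (simp add: matrix_mul_assoc)
  then show ?thesis
    by (simp add: lie_def matrix_mult_simps trace_sub matrix_mul_assoc)
qed

lemma trform_lie: "trform (lie X Y) Z = trform X (lie Y Z)"
  by (simp add: trform_def trace_lie)

lemma trform_commute: "trform X Y = trform Y X"
  unfolding trform_def by (subst trace_mul_sym) (rule refl)

lemma bounded_bilinear_trform: "bounded_bilinear (trform :: complex^'n^'n \<Rightarrow> _)"
proof -
  have "bilinear (trform :: complex^'n^'n \<Rightarrow> _)"
    unfolding bilinear_def linear_iff
    by (simp add: trform_def matrix_mult_simps trace_add scaleR_conv_cscale cscale_left cscale_right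
        trace_cscale)
  then show ?thesis
    by (simp add: bilinear_conv_bounded_bilinear)
qed

interpretation trform: bounded_bilinear "trform :: complex^'n^'n \<Rightarrow> _"
  by (rule bounded_bilinear_trform)

lemma matrix_inv_eqI:
  fixes A :: "complex^'n^'m"
  assumes "A ** B = mat 1" "B ** A = mat 1"
  shows "matrix_inv A = B"
proof -
  have "A ** matrix_inv A = mat 1 \<and> matrix_inv A ** A = mat 1"
    unfolding matrix_inv_def by (rule someI[of _ B]) (use assms in simp)
  then have "matrix_inv A = matrix_inv A ** (A ** B)"
    using assms by simp
  also have "\<dots> = B"
    using \<open>_ \<and> matrix_inv A ** A = mat 1\<close> by (simp add: matrix_mul_assoc)
  finally show ?thesis .
qed

lemma unitary_inv: "unitary A \<Longrightarrow> matrix_inv A = dagger A"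
  by (rule matrix_inv_eqI) (simp_all add: unitary_def)


section \<open>The matrix exponential\<close>

abbreviation mpow :: "complex^'n^'n \<Rightarrow> nat \<Rightarrow> complex^'n^'n" where
  "mpow A k \<equiv> (((**) A) ^^ k) (mat 1)"

text \<open>The Euclidean norm of entries is used, with submultiplicativity up to a constant
  \<open>K\<close>; the exponential series of \<open>norm A * K\<close> then dominates.\<close>

lemma mexp_sums:
  fixes A :: "complex^'n^'n"
  shows "(\<lambda>k. (1 / fact k) *\<^sub>R mpow A k) sums mexp A"
proof -
  obtain K where K: "K > 0" "\<And>(A :: complex^'n^'n) (B :: complex^'n^'n). norm (A ** B) \<le> norm A * norm B * K"
    using matrix_mult.pos_bounded by blast
  have pow: "norm (mpow A k) \<le> (norm A * K) ^ k * norm (mat 1 :: complex^'n^'n)" for k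
  proof (induction k)
    case (Suc k)
    have "norm (mpow A (Suc k)) \<le> norm A * norm (mpow A k) * K"
      using K(2)[of A "mpow A k"] by simp
    also have "\<dots> \<le> norm A * ((norm A * K) ^ k * norm (mat 1 :: complex^'n^'n)) * K"
      using Suc K by (intro mult_right_mono mult_left_mono) auto
    finally show ?case
      by (simp add: mult_ac)
  qed simp
  have "summable (\<lambda>k. (1 / fact k) *\<^sub>R mpow A k)"
  proof (rule summable_comparison_test')
    show "summable (\<lambda>k. inverse (fact k) * (norm A * K) ^ k * norm (mat 1 :: complex^'n^'n))"
      by (intro summable_mult2 summable_exp)
    show "norm ((1 / fact k) *\<^sub>R mpow A k)
        \<le> inverse (fact k) * (norm A * K) ^ k * norm (mat 1 :: complex^'n^'n)" for k
      using mult_left_mono[OF pow[of k], of "1 / fact k"] by (simp add: divide_inverse mult_ac)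
  qed
  then show ?thesis
    by (simp add: mexp_def summable_sums)
qed

text \<open>The relation passes to powers and hence to the series. With a Gram matrix as
  \<open>B\<close> it carries the infinitesimal invariance of a bilinear form over to the group;
  with \<open>X = Y\<close> it gives commutation.\<close>

lemma mexp_intertwine:
  assumes "B ** X = Y ** B"
  shows "B ** mexp X = mexp Y ** B"
proof -
  have pow: "B ** mpow X k = mpow Y k ** B" for k
  proof (induction k)
    case (Suc k)
    have "B ** mpow X (Suc k) = Y ** (B ** mpow X k)"
      using assms by (simp add: matrix_mul_assoc)
    then show ?case
      by (simp add: Suc matrix_mul_assoc)
  qed simp
  have "(\<lambda>k. B ** ((1 / fact k) *\<^sub>R mpow X k)) sums (B ** mexp X)"
    by (rule bounded_linear.sums[OF matrix_mult.bounded_linear_right mexp_sums])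
  moreover have "(\<lambda>k. ((1 / fact k) *\<^sub>R mpow Y k) ** B) sums (mexp Y ** B)"
    by (rule bounded_linear.sums[OF matrix_mult.bounded_linear_left mexp_sums])
  ultimately show ?thesis
    by (simp add: matrix_mult_simps pow sums_unique2)
qed

lemma mpow_Suc_right: "mpow X (Suc k) = mpow X k ** X"
  by (induction k) (simp_all add: matrix_mul_assoc)

text \<open>Reversing the order of factors is harmless on powers of a single matrix. The lemma
  serves both \<open>dagger\<close> and \<open>transpose\<close>.\<close>

lemma mexp_antihom:
  assumes f: "bounded_linear f" and "f (mat 1) = mat 1" and "\<And>A B. f (A ** B) = f B ** f A"
  shows "f (mexp X) = mexp (f X)"
proof -
  have pow: "f (mpow X k) = mpow (f X) k" for k
    by (induction k) (simp_all add: assms flip: mpow_Suc_right)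
  have "(\<lambda>k. f ((1 / fact k) *\<^sub>R mpow X k)) sums f (mexp X)"
    by (rule bounded_linear.sums[OF f mexp_sums])
  then have "(\<lambda>k. (1 / fact k) *\<^sub>R mpow (f X) k) sums f (mexp X)"
    by (simp add: linear_cmul[OF bounded_linear.linear[OF f]] pow del: funpow.simps)
  then show ?thesis
    using mexp_sums sums_unique2 by blast
qed

lemma dagger_mexp: "dagger (mexp X) = mexp (dagger X)"
  by (rule mexp_antihom) (simp_all add: bounded_linear_dagger dagger_mult)

lemma transpose_mexp: "transpose (mexp X) = mexp (transpose X)"
  by (rule mexp_antihom) (simp_all add: bounded_linear_transpose matrix_transpose_mul)

lemma mexp_zero [simp]: "mexp 0 = mat 1"
proof -
  have "(\<lambda>k. (1 / fact k) *\<^sub>R mpow (0 :: complex^'n^'n) k) sums (\<Sum>k\<in>{0}. (1 / fact k) *\<^sub>R mpow 0 k)"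
    by (rule sums_finite) (auto simp: matrix_mult.zero_left gr0_conv_Suc)
  then show ?thesis
    using mexp_sums sums_unique2 by fastforce
qed

text \<open>Pairing with a fixed matrix \<open>b\<close> turns the curve into a scalar power series
  in \<open>s\<close>, which may be differentiated termwise.\<close>

lemma mexp_has_vector_derivative:
  "((\<lambda>s. mexp (s *\<^sub>R X)) has_vector_derivative X ** mexp (s *\<^sub>R X)) (at s)"
proof -
  have pow: "mpow (s *\<^sub>R X) k = s ^ k *\<^sub>R mpow X k" for s k
    by (induction k) (simp_all add: matrix_mult_simps mult_ac)
  have "((\<lambda>s. mexp (s *\<^sub>R X) \<bullet> b) has_real_derivative (X ** mexp (s *\<^sub>R X)) \<bullet> b) (at s)" for b
  proof -
    define c where "c k = (1 / fact k) * (mpow X k \<bullet> b)" for k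
    have sums: "(\<lambda>k. c k * s ^ k) sums (mexp (s *\<^sub>R X) \<bullet> b)" for s
      using bounded_linear.sums[OF bounded_linear_inner_left mexp_sums[of "s *\<^sub>R X"], of b]
      by (simp add: c_def pow mult_ac)
    have "(\<lambda>k. (X ** ((1 / fact k) *\<^sub>R mpow (s *\<^sub>R X) k)) \<bullet> b) sums ((X ** mexp (s *\<^sub>R X)) \<bullet> b)"
      by (intro bounded_linear.sums[OF bounded_linear_inner_left]
          bounded_linear.sums[OF matrix_mult.bounded_linear_right] mexp_sums)
    \<comment> \<open>The factor \<open>Suc k\<close> produced by \<open>diffs\<close> cancels
      against the factorial, and the shift by one leaves a single factor \<open>X\<close> in
      front.\<close>
    moreover have "diffs c k * s ^ k = (X ** ((1 / fact k) *\<^sub>R mpow (s *\<^sub>R X) k)) \<bullet> b" for k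
    proof -
      have "real (Suc k) / fact (Suc k) = 1 / fact k"
        by (simp add: fact_Suc del: of_nat_Suc)
      then show ?thesis
        by (simp add: diffs_def c_def pow matrix_mult_simps times_divide_eq_left[symmetric] mult_ac
            del: of_nat_Suc fact_Suc times_divide_eq_left)
    qed
    ultimately have d: "(\<lambda>k. diffs c k * s ^ k) sums ((X ** mexp (s *\<^sub>R X)) \<bullet> b)"
      by simp
    have "((\<lambda>s. \<Sum>k. c k * s ^ k) has_real_derivative (\<Sum>k. diffs c k * s ^ k)) (at s)"
      using sums by (intro termdiffs_strong_converges_everywhere) (auto intro: sums_summable)
    then show ?thesis
      using sums d by (simp add: sums_iff)
  qed
  then show ?thesis
    unfolding has_vector_derivative_def
    by (subst has_derivative_componentwise_within) (simp add: has_field_derivative_def mult_commute_abs)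
qed

text \<open>The product of the exponentials of \<open>s *\<^sub>R X\<close> and
  \<open>(- s) *\<^sub>R X\<close> has derivative 0, hence keeps its value at
  \<open>s = 0\<close>.\<close>

lemma mexp_minus: "mexp X ** mexp (- X) = mat 1"
proof -
  define f where "f s = mexp (s *\<^sub>R X) ** mexp ((- s) *\<^sub>R X)" for s
  have comm: "X ** mexp (s *\<^sub>R X) = mexp (s *\<^sub>R X) ** X" for s
    by (rule mexp_intertwine) (simp add: matrix_mult_simps)
  have "(f has_vector_derivative 0) (at s)" for s
  proof -
    have "((\<lambda>s. mexp ((- s) *\<^sub>R X)) has_vector_derivative (-1) *\<^sub>R (X ** mexp ((- s) *\<^sub>R X))) (at s)"
      using vector_diff_chain_at[of uminus "-1" s "\<lambda>s. mexp (s *\<^sub>R X)",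
          OF _ mexp_has_vector_derivative[of X "- s"]]
      by (simp add: o_def has_vector_derivative_minus has_vector_derivative_id)
    from bounded_bilinear.has_vector_derivative[OF bounded_bilinear_matrix_mult
        mexp_has_vector_derivative[of X s] this]
    show ?thesis
      by (simp add: f_def[abs_def] comm matrix_mult_simps matrix_mul_assoc)
  qed
  then obtain c where "\<And>s. f s = c"
    using has_vector_derivative_zero_constant[of UNIV f] by auto
  then have "f 1 = f 0"
    by simp
  then show ?thesis
    by (simp add: f_def)
qed

lemma mexp_minus': "mexp (- X) ** mexp X = mat 1"
  using mexp_minus[of "- X"] by simp

lemma unitary_mexp: "dagger X = - X \<Longrightarrow> unitary (mexp X)"
  by (simp add: unitary_def dagger_mexp mexp_minus mexp_minus')


section \<open>Commuting symmetric operators\<close>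

text \<open>A maximizer of the Rayleigh quotient on the unit sphere of \<open>V\<close> is an
  eigenvector. Symmetry is required only on the invariant subspace \<open>V\<close>, so that the
  lemma applies to orthogonal complements.\<close>

lemma symmetric_eigenvector:
  fixes T :: "'a::euclidean_space \<Rightarrow> 'a"
  assumes V: "subspace V" "V \<noteq> {0}" and T: "linear T"
    and TV: "\<And>x. x \<in> V \<Longrightarrow> T x \<in> V"
    and sym: "\<And>x y. x \<in> V \<Longrightarrow> y \<in> V \<Longrightarrow> inner (T x) y = inner x (T y)"
  obtains x l where "x \<in> V" "x \<noteq> 0" "T x = l *\<^sub>R x"
proof -
  define S where "S = V \<inter> sphere 0 1"
  obtain v where v: "v \<in> V" "v \<noteq> 0"
    using V subspace_0 by blast
  then have "(1 / norm v) *\<^sub>R v \<in> S"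
    using V by (auto simp: S_def subspace_scale)
  moreover have "compact S"
    unfolding S_def by (intro closed_Int_compact closed_subspace V compact_sphere)
  moreover have "continuous_on S (\<lambda>x. inner (T x) x)"
    by (intro continuous_intros linear_continuous_on_compose[OF _ T] continuous_on_id)
  ultimately obtain x where x: "x \<in> S" and max: "\<And>y. y \<in> S \<Longrightarrow> inner (T y) y \<le> inner (T x) x"
    using continuous_attains_sup[of S "\<lambda>x. inner (T x) x"] by auto
  define l where "l = inner (T x) x"
  define B where "B y = l *\<^sub>R y - T y" for y
  have xV: "x \<in> V" "norm x = 1"
    using x by (auto simp: S_def)
  have BV: "B y \<in> V" if "y \<in> V" for y
    using that V TV by (simp add: B_def subspace_diff subspace_scale)
  have B_nonneg: "0 \<le> inner (B y) y" if "y \<in> V" for y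
  proof (cases "y = 0")
    case False
    define z where "z = (1 / norm y) *\<^sub>R y"
    have "z \<in> S"
      using False that V by (auto simp: S_def z_def subspace_scale)
    then have "inner (T z) z \<le> l"
      using max by (simp add: l_def)
    moreover have "inner (T y) y = (norm y)\<^sup>2 * inner (T z) z"
      using False by (simp add: z_def linear_cmul[OF T] power2_eq_square)
    ultimately have "inner (T y) y \<le> (norm y)\<^sup>2 * l"
      by (simp add: mult_left_mono)
    then show ?thesis
      by (simp add: B_def inner_diff_left power2_norm_eq_inner mult_ac)
  qed (simp add: B_def linear_0[OF T])
  have B_sym: "inner (B y) z = inner y (B z)" if "y \<in> V" "z \<in> V" for y z
    using sym[OF that] by (simp add: B_def inner_diff_left inner_diff_right)
  have B_lin: "B (y + s *\<^sub>R z) = B y + s *\<^sub>R B z" for y z s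
    by (simp add: B_def linear_add[OF T] linear_cmul[OF T] algebra_simps)
  have Bx: "inner (B x) x = 0"
    using xV by (simp add: B_def inner_diff_left l_def norm_eq_1)
  \<comment> \<open>The nonnegative form \<open>inner (B y) y\<close> vanishes at \<open>x\<close>, so \<open>x\<close> lies in its kernel.\<close>
  define y where "y = B x"
  have y: "y \<in> V"
    using BV xV by (simp add: y_def)
  have quad: "0 \<le> 2 * s * inner y y + s\<^sup>2 * inner (B y) y" for s
  proof -
    have "0 \<le> inner (B (x + s *\<^sub>R y)) (x + s *\<^sub>R y)"
      using V xV y by (intro B_nonneg) (simp add: subspace_add subspace_scale)
    also have "\<dots> = 2 * s * inner y y + s\<^sup>2 * inner (B y) y"
      using Bx B_sym[OF y \<open>x \<in> V\<close>]
      by (simp add: B_lin inner_add_left inner_add_right power2_eq_square y_def algebra_simps)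
    finally show ?thesis .
  qed
  have "inner y y = 0"
  proof (rule ccontr)
    assume "inner y y \<noteq> 0"
    then have pos: "inner y y > 0"
      by simp
    define c where "c = inner (B y) y"
    have c: "c \<ge> 0"
      using B_nonneg[OF y] by (simp add: c_def)
    \<comment> \<open>A negative \<open>s\<close> so small that the linear term of the quadratic
      dominates; the summand 1 covers \<open>c = 0\<close> and gives
      \<open>s * c \<ge> - inner y y\<close>.\<close>
    define s where "s = - inner y y / (c + 1)"
    have "s < 0"
      using pos c by (simp add: s_def)
    have "s * c \<ge> - inner y y"
      using pos c by (simp add: s_def field_simps)
    then have "2 * inner y y + s * c > 0"
      using pos by linarith
    then have "s * (2 * inner y y + s * c) < 0"
      using \<open>s < 0\<close> by (rule mult_neg_pos[rotated])
    with quad[of s] show False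
      by (simp add: c_def power2_eq_square algebra_simps)
  qed
  then have "T x = l *\<^sub>R x"
    by (simp add: y_def B_def)
  moreover have "x \<noteq> 0"
    using xV by auto
  ultimately show ?thesis
    using that xV by blast
qed

text \<open>If all operators are scalar on \<open>V\<close>, any nonzero vector serves. Otherwise
  some \<open>T h\<close> has a proper nonzero eigenspace in \<open>V\<close>, which the other
  operators preserve by commutativity, so the dimension drops. \<open>K\<close> may be
  infinite.\<close>

lemma commuting_symmetric_joint_eigenvector:
  fixes T :: "'k \<Rightarrow> 'a::euclidean_space \<Rightarrow> 'a"
  assumes T: "\<And>h. h \<in> K \<Longrightarrow> linear (T h)"
    and comm: "\<And>h k x. h \<in> K \<Longrightarrow> k \<in> K \<Longrightarrow> T h (T k x) = T k (T h x)"
    and V: "subspace V" "V \<noteq> {0}"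
    and TV: "\<And>h x. h \<in> K \<Longrightarrow> x \<in> V \<Longrightarrow> T h x \<in> V"
    and sym: "\<And>h x y. h \<in> K \<Longrightarrow> x \<in> V \<Longrightarrow> y \<in> V \<Longrightarrow> inner (T h x) y = inner x (T h y)"
  shows "\<exists>x\<in>V. x \<noteq> 0 \<and> (\<forall>h\<in>K. \<exists>l. T h x = l *\<^sub>R x)"
  using V TV sym
proof (induction "dim V" arbitrary: V rule: less_induct)
  case less
  show ?case
  proof (cases "\<forall>h\<in>K. \<exists>l. \<forall>x\<in>V. T h x = l *\<^sub>R x")
    case True
    then show ?thesis
      using less.prems(1,2) subspace_0 by blast
  next
    case False
    then obtain h where h: "h \<in> K" and not: "\<And>l. \<exists>x\<in>V. T h x \<noteq> l *\<^sub>R x"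
      by blast
    obtain x l where x: "x \<in> V" "x \<noteq> 0" "T h x = l *\<^sub>R x"
      using symmetric_eigenvector[of V "T h"] less.prems h T by metis
    define W where "W = {x \<in> V. T h x = l *\<^sub>R x}"
    have W: "subspace W"
      using less.prems(1) T[OF h]
      by (auto simp: W_def subspace_def linear_add linear_cmul linear_0 algebra_simps)
    have "W \<subset> V"
      using not[of l] by (auto simp: W_def)
    then have "dim W < dim V"
      using W less.prems(1) by (intro dim_psubset) (simp add: span_eq_iff[THEN iffD2])
    moreover have "W \<noteq> {0}"
      using x by (auto simp: W_def)
    moreover have "T k y \<in> W" if "k \<in> K" "y \<in> W" for k y
      using that less.prems(3) comm[OF h, of k] linear_cmul[OF T[of k]] by (simp add: W_def)
    moreover have "inner (T k y) z = inner y (T k z)" if "k \<in> K" "y \<in> W" "z \<in> W" for k y z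
      using that less.prems(4) by (simp add: W_def)
    ultimately show ?thesis
      using less.hyps[of W] W \<open>W \<subset> V\<close> by blast
  qed
qed


section \<open>Self-adjoint complex matrix Lie algebras\<close>

lemma csubspace_subspace: "csubspace V \<Longrightarrow> subspace V"
  by (simp add: csubspace_def subspace_def scaleR_conv_cscale)

text \<open>The common ground of the three classical types. Stability under \<open>dagger\<close>
  makes \<open>gC\<close> the complexification of its skew-hermitian part.\<close>

locale dagger_lie_algebra =
  fixes gC :: "(complex^'n^'n) set"
  assumes csub: "csubspace gC"
    and lie_closed: "X \<in> gC \<Longrightarrow> Y \<in> gC \<Longrightarrow> lie X Y \<in> gC"
    and dagger_closed: "X \<in> gC \<Longrightarrow> dagger X \<in> gC"
begin

abbreviation "\<gg> \<equiv> compact_form gC"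

lemma gC_add: "X \<in> gC \<Longrightarrow> Y \<in> gC \<Longrightarrow> X + Y \<in> gC"
  and gC_cscale: "X \<in> gC \<Longrightarrow> c *\<^sub>C X \<in> gC"
  and gC_zero: "0 \<in> gC"
  using csub by (auto simp: csubspace_def)

lemma gC_minus: "X \<in> gC \<Longrightarrow> - X \<in> gC"
  using gC_cscale[of X "-1"] by (simp add: cscale_minus_left)

lemma gC_diff: "X \<in> gC \<Longrightarrow> Y \<in> gC \<Longrightarrow> X - Y \<in> gC"
  using gC_add[of X "- Y"] by (simp add: gC_minus)

lemma subspace_gC: "subspace gC"
  by (rule csubspace_subspace[OF csub])

section \<open>The compact form, its definite trace form and Riesz representation\<close>

lemma compact_formI: "X \<in> gC \<Longrightarrow> dagger X = - X \<Longrightarrow> X \<in> \<gg>"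
  by (simp add: compact_form_def)

lemma compact_formD: "X \<in> \<gg> \<Longrightarrow> X \<in> gC" "X \<in> \<gg> \<Longrightarrow> dagger X = - X"
  by (simp_all add: compact_form_def)

lemma subspace_compact_form: "subspace \<gg>"
  by (auto simp: subspace_def compact_form_def gC_zero gC_add gC_cscale dagger_simps
      scaleR_conv_cscale cscale_minus_right)

lemma compact_form_lie: "X \<in> \<gg> \<Longrightarrow> Y \<in> \<gg> \<Longrightarrow> lie X Y \<in> \<gg>"
  by (simp add: compact_form_def lie_closed dagger_lie lie_simps)

lemma skew_part: "X \<in> gC \<Longrightarrow> X - dagger X \<in> \<gg>"
  by (simp add: compact_form_def gC_diff dagger_closed dagger_simps)

lemma i_herm_part: "X \<in> gC \<Longrightarrow> \<i> *\<^sub>C (X + dagger X) \<in> \<gg>"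
  by (simp add: compact_form_def gC_add gC_cscale dagger_closed dagger_simps cscale_minus_left add.commute)

text \<open>Such an \<open>X\<close> is both hermitian and skew-hermitian. This is what will make
  the sum of \<open>\<gg>\<close> and \<open>b_minus\<close> direct.\<close>

lemma i_in_compact_form: "X \<in> \<gg> \<Longrightarrow> \<i> *\<^sub>C X \<in> \<gg> \<Longrightarrow> X = 0"
proof -
  assume "X \<in> \<gg>" "\<i> *\<^sub>C X \<in> \<gg>"
  then have "\<i> *\<^sub>C X = - (\<i> *\<^sub>C X)"
    by (simp add: compact_form_def dagger_simps cscale_minus_left cscale_minus_right)
  then have "\<i> *\<^sub>C X + \<i> *\<^sub>C X = 0"
    by (metis add.right_inverse)
  then have "(2 * \<i>) *\<^sub>C X = 0"
    by (simp add: cscale_add_left[symmetric])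
  then show "X = 0"
    by simp
qed

text \<open>On the compact form \<open>dagger\<close> is minus the identity, so the trace form is
  negative definite there.\<close>

lemma trform_inner: "X \<in> \<gg> \<Longrightarrow> trform X Y = - inner X Y"
  by (simp add: trform_def inner_matrix compact_formD matrix_mult_simps trace_minus)

lemma trform_separates:
  assumes "X \<in> \<gg>" "\<And>Y. Y \<in> \<gg> \<Longrightarrow> trform X Y = 0"
  shows "X = 0"
  using assms(2)[OF assms(1)] trform_inner[OF assms(1), of X] by simp

text \<open>Riesz representation by an orthonormal basis of \<open>V\<close>; the minus sign in
  \<open>- d\<close> compensates the negative sign of the trace form. \<open>D\<close> is linear
  only on \<open>V\<close> because covectors of the orbit are cut off to 0 outside the tangent
  space.\<close>

lemma trform_represent_subspace:
  assumes V: "subspace V" "V \<subseteq> \<gg>"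
    and add: "\<And>v w. v \<in> V \<Longrightarrow> w \<in> V \<Longrightarrow> D (v + w) = D v + D w"
    and scale: "\<And>c v. v \<in> V \<Longrightarrow> D (c *\<^sub>R v) = c * D v"
  obtains \<xi> where "\<xi> \<in> V" "\<And>v. v \<in> V \<Longrightarrow> trform \<xi> v = (D v :: real)"
proof -
  obtain B where B: "B \<subseteq> V" "pairwise orthogonal B" "\<And>x. x \<in> B \<Longrightarrow> norm x = 1"
      "independent B" "span B = V"
    using orthonormal_basis_subspace[OF V(1)] by metis
  have fin: "finite B"
    using B(4) by (rule independent_imp_finite)
  define d where "d = (\<Sum>b\<in>B. D b *\<^sub>R b)"
  have d: "d \<in> V"
    unfolding d_def using V(1) B(1) by (intro subspace_sum subspace_scale) auto
  have D0: "D 0 = 0"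
    using scale[of 0 0] V(1) by (simp add: subspace_0)
  have base: "inner d b = D b" if "b \<in> B" for b
  proof -
    have "inner d b = (\<Sum>b'\<in>B. if b' = b then D b else 0)"
      unfolding d_def inner_sum_left
    proof (rule sum.cong)
      fix b' assume "b' \<in> B"
      then show "inner (D b' *\<^sub>R b') b = (if b' = b then D b else 0)"
        using B(2) B(3)[OF that] that
        by (auto simp: pairwise_def orthogonal_def norm_eq_1)
    qed simp
    then show ?thesis
      using fin that by simp
  qed
  have "inner d v = D v" if "v \<in> V" for v
  proof -
    have "v \<in> span B"
      using that B(5) by simp
    then have "v \<in> V \<and> inner d v = D v"
    proof (induction rule: span_induct_alt)
      case base
      then show ?case
        using D0 V(1) by (simp add: subspace_0)
    next
      case (step c b w)
      then have "b \<in> V" "c *\<^sub>R b \<in> V"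
        using B(1) V(1) by (auto simp: subspace_scale)
      then show ?case
        using step V(1) by (simp add: inner_add_right add scale base subspace_add)
    qed
    then show ?thesis ..
  qed
  then have "trform (- d) v = D v" if "v \<in> V" for v
    using d that V trform_inner[of "- d" v] by (auto simp: subspace_neg subset_eq)
  then show ?thesis
    using that[of "- d"] d V(1) by (simp add: subspace_neg)
qed

lemma trform_represent:
  assumes "linear D"
  obtains \<xi> where "\<xi> \<in> \<gg>" "\<And>X. X \<in> \<gg> \<Longrightarrow> trform \<xi> X = (D X :: real)"
  using trform_represent_subspace[OF subspace_compact_form order_refl, of D] assms
  by (metis linear_add linear_cmul real_scaleR_def)

lemma tang_subset: "x \<in> \<gg> \<Longrightarrow> tang \<gg> x \<subseteq> \<gg>"
  by (auto simp: tang_def compact_form_lie)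

lemma subspace_tang: "subspace (tang \<gg> x)"
proof -
  have "linear (\<lambda>X. lie X x)"
    by (simp add: linear_iff lie_simps)
  then show ?thesis
    unfolding tang_def by (rule linear_subspace_image) (rule subspace_compact_form)
qed

lemma lie_in_tang: "X \<in> \<gg> \<Longrightarrow> lie x X \<in> tang \<gg> x"
proof -
  assume "X \<in> \<gg>"
  then have "- X \<in> \<gg>"
    by (simp add: subspace_neg subspace_compact_form)
  moreover have "lie x X = lie (- X) x"
    by (simp add: lie_def matrix_mult_simps)
  ultimately show ?thesis
    unfolding tang_def by blast
qed

end


section \<open>The root decomposition\<close>

locale cartan_lie_algebra = dagger_lie_algebra gC for gC :: "(complex^'n^'n) set" +
  fixes t :: "(complex^'n^'n) set"
  assumes cartan: "cartan_subalgebra (compact_form gC) t"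
begin

lemma cartanD: "H \<in> t \<Longrightarrow> H \<in> \<gg>" "H \<in> t \<Longrightarrow> H' \<in> t \<Longrightarrow> lie H H' = 0"
  "H \<in> t \<Longrightarrow> dagger H = - H" "H \<in> t \<Longrightarrow> H \<in> gC"
  "X \<in> \<gg> \<Longrightarrow> (\<And>H. H \<in> t \<Longrightarrow> lie X H = 0) \<Longrightarrow> X \<in> t"
  using cartan by (auto simp: cartan_subalgebra_def compact_form_def)

lemma csubspace_root_space: "csubspace (root_space gC t \<alpha>)"
  by (auto simp: csubspace_def root_space_def gC_zero gC_add gC_cscale lie_simps cscale_add_right mult_ac)

lemma root_spaceD: "E \<in> root_space gC t \<alpha> \<Longrightarrow> E \<in> gC"
  "E \<in> root_space gC t \<alpha> \<Longrightarrow> H \<in> t \<Longrightarrow> lie H E = \<alpha> H *\<^sub>C E"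
  by (simp_all add: root_space_def)

text \<open>As \<open>H\<close> is skew-hermitian, \<open>lie H\<close> commutes with
  \<open>dagger\<close>, and invariance of the trace moves it to the other factor.\<close>

lemma ad_skew_adjoint:
  assumes "H \<in> t"
  shows "inner (lie H X) Y = - inner X (lie H Y)"
proof -
  have "dagger (lie H X) = lie H (dagger X)"
    using cartanD(3)[OF assms] by (simp add: dagger_lie lie_simps)
  then have "inner (lie H X) Y = Re (trace (lie H (dagger X) ** Y))"
    by (simp add: inner_matrix)
  also have "\<dots> = Re (trace (- lie (dagger X) H ** Y))"
    by (subst lie_anticomm) simp
  finally show ?thesis
    by (simp add: inner_matrix trace_lie matrix_mult_simps trace_minus)
qed

text \<open>Since \<open>lie H\<close> commutes with \<open>dagger\<close>, the skew-hermitian and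
  the hermitian part of \<open>X\<close> commute with \<open>t\<close> separately, and maximality of
  \<open>t\<close> applies to each.\<close>

lemma centralizer_decomp:
  assumes X: "X \<in> gC" and comm: "\<And>H. H \<in> t \<Longrightarrow> lie H X = 0"
  obtains A B where "A \<in> t" "B \<in> t" "X = A + \<i> *\<^sub>C B"
proof -
  define A where "A = (1/2) *\<^sub>C (X - dagger X)"
  define B where "B = (- (1/2)) *\<^sub>C (\<i> *\<^sub>C (X + dagger X))"
  have comm': "lie H (dagger X) = 0" if "H \<in> t" for H
    using comm[OF that] dagger_lie[of H X] cartanD(3)[OF that] by (simp add: lie_simps)
  have real: "of_real r *\<^sub>C Y \<in> \<gg>" if "Y \<in> \<gg>" for Y r
    using that subspace_compact_form by (simp add: scaleR_conv_cscale[symmetric] subspace_scale)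
  have "A \<in> \<gg>"
    using real[OF skew_part[OF X], of "1/2"] by (simp add: A_def)
  moreover have "B \<in> \<gg>"
    using real[OF i_herm_part[OF X], of "-1/2"] by (simp add: B_def)
  moreover have "lie A H = 0" "lie B H = 0" if "H \<in> t" for H
    using lie_anticomm[of _ H] comm[OF that] comm'[OF that]
    by (simp_all add: A_def B_def lie_simps)
  ultimately have "A \<in> t" "B \<in> t"
    using cartanD(5) by blast+
  moreover have "X = A + \<i> *\<^sub>C B"
    by (simp add: A_def B_def vec_eq_iff cscale_def field_simps)
  ultimately show ?thesis
    using that by blast
qed

text \<open>The operators \<open>\<i> ad H\<close> are symmetric and commute. Hence a nonzero orthogonal complement of the
  Cartan subalgebra and the root spaces would contain a joint eigenvector.\<close>

lemma gC_span:
  "gC \<subseteq> span (t \<union> (*\<^sub>C) \<i> ` t \<union> (\<Union>\<alpha>\<in>roots gC t. root_space gC t \<alpha>))" (is "_ \<subseteq> span ?W0")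
proof (rule ccontr)
  define W where "W = span ?W0"
  assume not: "\<not> gC \<subseteq> span ?W0"
  then obtain x0 where x0: "x0 \<in> gC" "x0 \<notin> W"
    by (auto simp: W_def)
  have "?W0 \<subseteq> gC"
    by (auto simp: cartanD gC_cscale root_spaceD)
  then have W_gC: "W \<subseteq> gC"
    unfolding W_def by (rule span_minimal) (rule subspace_gC)
  \<comment> \<open>Multiplication by the imaginary unit is itself skew for the real inner product,
    so the product of two commuting skew operators is symmetric.\<close>
  define T where "T H X = \<i> *\<^sub>C lie H X" for H X :: "complex^'n^'n"
  have T_lin: "linear (T H)" for H
    by (simp add: T_def linear_iff lie_simps cscale_add_right scaleR_conv_cscale mult_ac)
  have T_comm: "T H (T H' X) = T H' (T H X)" if "H \<in> t" "H' \<in> t" for H H' X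
    using lie_jacobi[of H H' X] cartanD(2)[OF that] by (simp add: T_def lie_simps)
  have inner_i: "inner (\<i> *\<^sub>C X) Y = - inner X (\<i> *\<^sub>C Y)" for X Y :: "complex^'n^'n"
    by (simp add: inner_matrix dagger_simps cscale_left cscale_right cscale_minus_left matrix_mult_simps
        trace_minus)
  have T_sym: "inner (T H X) Y = inner X (T H Y)" if "H \<in> t" for H X Y
  proof -
    have "lie H (\<i> *\<^sub>C Y) = \<i> *\<^sub>C lie H Y"
      by (simp add: lie_simps)
    then show ?thesis
      by (simp add: T_def inner_i ad_skew_adjoint[OF that])
  qed
  have T_W: "T H w \<in> W" if H: "H \<in> t" and w: "w \<in> W" for H w
  proof -
    have "T H ` W \<subseteq> span (T H ` ?W0)"
      unfolding W_def by (simp add: linear_span_image[OF T_lin])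
    also have "T H ` ?W0 \<subseteq> W"
    proof safe
      fix X assume "X \<in> t"
      then show "T H X \<in> W" "T H (\<i> *\<^sub>C X) \<in> W"
        using H by (simp_all add: T_def cartanD lie_simps W_def span_zero)
    next
      fix \<alpha> E assume \<alpha>: "\<alpha> \<in> roots gC t" and E: "E \<in> root_space gC t \<alpha>"
      have "T H E = (\<i> * \<alpha> H) *\<^sub>C E"
        using E H by (simp add: T_def root_spaceD)
      then have "T H E \<in> root_space gC t \<alpha>"
        using csubspace_root_space E by (simp add: csubspace_def)
      then show "T H E \<in> W"
        unfolding W_def using \<alpha> by (intro span_base) blast
    qed
    then have "span (T H ` ?W0) \<subseteq> W"
      unfolding W_def by (simp add: span_minimal)
    finally show ?thesis
      using w by blast
  qed
  define V where "V = {x \<in> gC. \<forall>w\<in>W. inner w x = 0}"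
  have V: "subspace V"
    using subspace_gC by (auto simp: V_def subspace_def inner_add_right)
  obtain y z where yz: "y \<in> W" "\<And>w. w \<in> W \<Longrightarrow> orthogonal z w" "x0 = y + z"
    using orthogonal_subspace_decomp_exists[of ?W0 x0] unfolding W_def by metis
  have "z = x0 - y"
    using yz by simp
  then have "z \<in> gC"
    using yz(1) x0(1) W_gC gC_diff by blast
  then have "z \<in> V"
    using yz(2) by (simp add: V_def orthogonal_def inner_commute)
  moreover have "z \<noteq> 0"
    using yz x0 by auto
  ultimately have V0: "V \<noteq> {0}"
    by blast
  have TV: "T H x \<in> V" if "H \<in> t" "x \<in> V" for H x
  proof -
    have "inner w (T H x) = 0" if "w \<in> W" for w
      using T_W[OF \<open>H \<in> t\<close> that] \<open>x \<in> V\<close> by (simp add: V_def flip: T_sym[OF \<open>H \<in> t\<close>])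
    then show ?thesis
      using that by (simp add: V_def T_def gC_cscale lie_closed cartanD)
  qed
  have "\<exists>x\<in>V. x \<noteq> 0 \<and> (\<forall>H\<in>t. \<exists>l. T H x = l *\<^sub>R x)"
    by (rule commuting_symmetric_joint_eigenvector)
      (assumption | rule T_lin T_comm V V0 TV T_sym)+
  then obtain x where x: "x \<in> V" "x \<noteq> 0" "\<And>H. H \<in> t \<Longrightarrow> \<exists>l. T H x = l *\<^sub>R x"
    by blast
  have "\<exists>c. lie H x = c *\<^sub>C x" if H: "H \<in> t" for H
  proof -
    obtain l where "T H x = l *\<^sub>R x"
      using x(3)[OF H] by blast
    then have "(- \<i>) *\<^sub>C T H x = (- \<i>) *\<^sub>C l *\<^sub>R x"
      by simp
    then show ?thesis
      by (auto simp: T_def scaleR_conv_cscale)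
  qed
  then obtain c where c: "\<And>H. H \<in> t \<Longrightarrow> lie H x = c H *\<^sub>C x"
    by metis
  have xgC: "x \<in> gC"
    using x(1) by (simp add: V_def)
  \<comment> \<open>A joint eigenvector of weight 0 commutes with \<open>t\<close> and is a complex
    combination of \<open>t\<close>; any other one is a root vector. Either way it lies in
    \<open>W\<close>, to which it is also orthogonal.\<close>
  have "x \<in> W"
  proof (cases "\<forall>H\<in>t. c H = 0")
    case True
    then obtain A B where "A \<in> t" "B \<in> t" "x = A + \<i> *\<^sub>C B"
      using centralizer_decomp[OF xgC] c by (metis cscale_zero_left)
    then show ?thesis
      unfolding W_def by (auto intro!: span_add intro: span_base)
  next
    case False
    \<comment> \<open>Cut off outside \<open>t\<close>, as the convention in \<open>roots\<close>
      demands.\<close>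
    define \<alpha> where "\<alpha> H = (if H \<in> t then c H else 0)" for H
    have "x \<in> root_space gC t \<alpha>"
      using xgC c by (simp add: root_space_def \<alpha>_def)
    moreover have "\<alpha> \<in> roots gC t"
      using False x(2) calculation by (auto simp: roots_def \<alpha>_def)
    ultimately show ?thesis
      unfolding W_def by (intro span_base) blast
  qed
  then have "inner x x = 0"
    using x(1) by (simp add: V_def)
  then show False
    using x(2) by simp
qed

text \<open>The induction principle behind all identities for \<open>J\<close>. The complex subspace
  is taken inside \<open>gC\<close>, because \<open>J\<close> is linear only there; it also takes
  care of the imaginary multiples of \<open>t\<close>.\<close>

lemma root_induct:
  assumes "X \<in> gC" and P: "csubspace {X \<in> gC. P X}"
    and "\<And>H. H \<in> t \<Longrightarrow> P H"
    and "\<And>\<alpha> E. \<alpha> \<in> roots gC t \<Longrightarrow> E \<in> root_space gC t \<alpha> \<Longrightarrow> P E"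
  shows "P X"
proof -
  have "\<i> *\<^sub>C H \<in> {X \<in> gC. P X}" if "H \<in> t" for H
    using P that assms(3) cartanD(4) unfolding csubspace_def by blast
  then have "t \<union> (*\<^sub>C) \<i> ` t \<union> (\<Union>\<alpha>\<in>roots gC t. root_space gC t \<alpha>) \<subseteq> {X \<in> gC. P X}"
    using assms(3,4) by (auto simp: cartanD root_spaceD)
  then have "span (t \<union> (*\<^sub>C) \<i> ` t \<union> (\<Union>\<alpha>\<in>roots gC t. root_space gC t \<alpha>)) \<subseteq> {X \<in> gC. P X}"
    by (rule span_minimal) (rule csubspace_subspace[OF P])
  then show ?thesis
    using gC_span assms(1) by blast
qed

text \<open>The real inner product of \<open>lie H E\<close> with \<open>E\<close> vanishes by
  skewness and equals the real part of \<open>\<alpha> H\<close> times the squared norm of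
  \<open>E\<close>.\<close>

lemma root_imaginary:
  assumes E: "E \<in> root_space gC t \<alpha>" "E \<noteq> 0" and H: "H \<in> t"
  shows "cnj (\<alpha> H) = - \<alpha> H"
proof -
  have "inner (lie H E) E = 0"
    using ad_skew_adjoint[OF H, of E E] by (simp add: inner_commute)
  moreover have "inner (lie H E) E = Re (\<alpha> H) * inner E E"
  proof -
    have "trace (dagger E ** E) = cnj (trace (dagger E ** E))"
      using trace_dagger[of "dagger E ** E"] by (simp add: dagger_mult)
    then have "Im (trace (dagger E ** E)) = 0"
      by (simp add: complex_eq_iff)
    then show ?thesis
      using root_spaceD(2)[OF E(1) H]
      by (simp add: inner_matrix dagger_simps cscale_left trace_cscale)
  qed
  ultimately show ?thesis
    using E(2) by (simp add: complex_eq_iff)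
qed

lemma dagger_root_space:
  assumes "E \<in> root_space gC t \<alpha>"
  shows "dagger E \<in> root_space gC t (\<lambda>H. - \<alpha> H)"
proof (cases "E = 0")
  case False
  have "lie H (dagger E) = - \<alpha> H *\<^sub>C dagger E" if "H \<in> t" for H
  proof -
    have "lie H (dagger E) = dagger (lie H E)"
      using cartanD(3)[OF that] by (simp add: dagger_lie lie_simps)
    then show ?thesis
      using root_imaginary[OF assms False that] root_spaceD(2)[OF assms that]
      by (simp add: dagger_simps)
  qed
  then show ?thesis
    using assms by (simp add: root_space_def dagger_closed)
qed (simp add: root_space_def gC_zero lie_simps)

text \<open>Invariance of the trace gives
  \<open>(\<alpha> H + \<beta> H) * trace (X ** Y) = 0\<close>. The weights are arbitrary functions,
  so \<open>t\<close>, as part of the space of weight 0, is included.\<close>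

lemma trace_root_orthogonal:
  assumes "X \<in> root_space gC t \<alpha>" "Y \<in> root_space gC t \<beta>" "H \<in> t" "\<alpha> H + \<beta> H \<noteq> 0"
  shows "trace (X ** Y) = 0"
proof -
  have "\<beta> H * trace (X ** Y) = trace (X ** lie H Y)"
    using assms by (simp add: root_spaceD cscale_right trace_cscale)
  also have "\<dots> = trace (- lie H X ** Y)"
    by (simp add: trace_lie[symmetric] lie_anticomm[of H X] matrix_mult_simps trace_minus)
  also have "\<dots> = - (\<alpha> H * trace (X ** Y))"
    using assms by (simp add: root_spaceD cscale_left trace_cscale matrix_mult_simps trace_minus)
  finally have "(\<alpha> H + \<beta> H) * trace (X ** Y) = 0"
    by (simp add: algebra_simps)
  then show ?thesis
    using assms by simp
qed

lemma cartan_root_space: "H \<in> t \<Longrightarrow> H \<in> root_space gC t (\<lambda>_. 0)"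
  by (simp add: root_space_def cartanD)

end


section \<open>The matrix group\<close>

text \<open>\<open>conn_group\<close> grows by factors on the left, whereas \<open>dagger\<close>
  reverses products and produces factors on the right.\<close>

lemma conn_group_mult_mexp: "g \<in> conn_group K \<Longrightarrow> X \<in> K \<Longrightarrow> g ** mexp X \<in> conn_group K"
proof (induction rule: conn_group.induct)
  case one
  then show ?case
    using conn_group.step[OF _ conn_group.one] by simp
next
  case (step Y g)
  then show ?case
    using conn_group.step[of Y K "g ** mexp X"] by (simp add: matrix_mul_assoc)
qed

lemma unitary_mult: "unitary g \<Longrightarrow> unitary h \<Longrightarrow> unitary (g ** h)"
proof -
  assume g: "unitary g" and h: "unitary h"
  have "dagger h ** (dagger g ** g) ** h = mat 1" "g ** (h ** dagger h) ** dagger g = mat 1"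
    using g h unfolding unitary_def by simp_all
  then show ?thesis
    by (simp add: unitary_def dagger_mult matrix_mul_assoc)
qed

lemma conn_group_unitary:
  assumes "g \<in> conn_group K" and "\<And>X. X \<in> K \<Longrightarrow> dagger X = - X"
  shows "unitary g"
  using assms(1)
  by (induction rule: conn_group.induct) (simp_all add: unitary_def[of "mat 1"] unitary_mult unitary_mexp assms(2))

lemma conn_group_dagger:
  assumes "g \<in> conn_group K" and "subspace K" and "\<And>X. X \<in> K \<Longrightarrow> dagger X = - X"
  shows "dagger g \<in> conn_group K"
  using assms(1)
  by (induction rule: conn_group.induct)
    (simp_all add: conn_group.one dagger_mult dagger_mexp assms conn_group_mult_mexp subspace_neg)

lemma Ad_unitary: "unitary g \<Longrightarrow> Ad g X = g ** X ** dagger g"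
  by (simp add: Ad_def unitary_inv)

lemma unitary_dagger: "unitary g \<Longrightarrow> unitary (dagger g)"
  by (simp add: unitary_def)

lemma Ad_linear:
  "Ad g (X + Y) = Ad g X + Ad g Y" "Ad g (X - Y) = Ad g X - Ad g Y" "Ad g (c *\<^sub>C X) = c *\<^sub>C Ad g X"
  by (simp_all add: Ad_def matrix_mult_simps cscale_left cscale_right)

lemma mult_unitary_cancel:
  assumes "unitary g"
  shows "X ** g ** dagger g = X" "Y ** dagger g ** g = Y"
  using assms by (simp_all add: unitary_def flip: matrix_mul_assoc)

lemma Ad_dagger_cancel:
  assumes "unitary g"
  shows "Ad g (Ad (dagger g) X) = X" "Ad (dagger g) (Ad g X) = X"
  using assms
  by (simp_all add: Ad_unitary unitary_dagger matrix_mul_assoc mult_unitary_cancel)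
    (simp_all add: unitary_def)

lemma Ad_lie: "unitary g \<Longrightarrow> Ad g (lie X Y) = lie (Ad g X) (Ad g Y)"
  by (simp add: Ad_unitary lie_def matrix_mult_simps matrix_mul_assoc mult_unitary_cancel)

lemma trform_Ad: "unitary g \<Longrightarrow> trform X (Ad (dagger g) Y) = trform (Ad g X) Y"
  using trace_mul_sym[of "X ** dagger g ** Y" g]
  by (simp add: trform_def Ad_unitary unitary_dagger matrix_mul_assoc)


section \<open>The complex structure and the grading element\<close>

text \<open>\<open>Ad_closed\<close> is an assumption here because its verification depends on the
  type of the algebra; \<open>classical_Ad_closed\<close> supplies it.\<close>

locale hermitian_root_data = cartan_lie_algebra gC t for gC t :: "(complex^'n^'n) set" +
  fixes \<Delta> \<phi> \<rho> J
  assumes simple: "simple_system (roots gC t) \<Delta>"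
    and noncompact: "noncompact_simple_root (roots gC t) \<Delta> \<phi>"
    and rho_center: "\<rho> \<in> lie_center (h_sub gC t \<Delta> \<phi>)"
    and phi_rho: "\<phi> \<rho> = \<i>"
    and J: "is_J gC t \<Delta> J"
    and Ad_closed: "g \<in> conn_group (compact_form gC) \<Longrightarrow> X \<in> gC \<Longrightarrow> g ** X ** dagger g \<in> gC"
begin

abbreviation "\<Phi> \<equiv> roots gC t"

section \<open>Reality and skewness of \<open>J\<close>\<close>

lemma J_closed: "X \<in> gC \<Longrightarrow> J X \<in> gC"
  and J_add: "X \<in> gC \<Longrightarrow> Y \<in> gC \<Longrightarrow> J (X + Y) = J X + J Y"
  and J_cscale: "X \<in> gC \<Longrightarrow> J (c *\<^sub>C X) = c *\<^sub>C J X"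
  and J_cartan: "H \<in> t \<Longrightarrow> J H = 0"
  and J_pos: "\<alpha> \<in> pos_roots \<Phi> \<Delta> \<Longrightarrow> E \<in> root_space gC t \<alpha> \<Longrightarrow> J E = \<i> *\<^sub>C E"
  and J_neg: "\<alpha> \<in> neg_roots \<Phi> \<Delta> \<Longrightarrow> E \<in> root_space gC t \<alpha> \<Longrightarrow> J E = (- \<i>) *\<^sub>C E"
  using J by (auto simp: is_J_def)

lemma J_zero: "J 0 = 0"
  using J_cscale[of 0 0] gC_zero by simp

lemma J_minus: "X \<in> gC \<Longrightarrow> J (- X) = - J X"
  using J_cscale[of X "-1"] by (simp add: cscale_minus_left)

lemma J_diff: "X \<in> gC \<Longrightarrow> Y \<in> gC \<Longrightarrow> J (X - Y) = J X - J Y"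
  using J_add[of X "- Y"] by (simp add: gC_minus J_minus)

lemma root_cases:
  assumes "\<alpha> \<in> \<Phi>"
  obtains "\<alpha> \<in> pos_roots \<Phi> \<Delta>" | "\<alpha> \<in> neg_roots \<Phi> \<Delta>"
  using assms simple unfolding simple_system_def by blast

lemma neg_root_negative: "\<alpha> \<in> neg_roots \<Phi> \<Delta> \<Longrightarrow> (\<lambda>H. - \<alpha> H) \<in> pos_roots \<Phi> \<Delta>"
  by (simp add: neg_roots_def)

lemma pos_root_negative:
  assumes "\<alpha> \<in> pos_roots \<Phi> \<Delta>" "(\<lambda>H. - \<alpha> H) \<in> \<Phi>"
  shows "(\<lambda>H. - \<alpha> H) \<in> neg_roots \<Phi> \<Delta>"
  using assms by (simp add: neg_roots_def)

text \<open>\<open>dagger\<close> maps a nonzero root vector to one for the opposite root.\<close>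

lemma root_negative: "\<alpha> \<in> \<Phi> \<Longrightarrow> (\<lambda>H. - \<alpha> H) \<in> \<Phi>"
  unfolding roots_def
  using dagger_root_space[of _ \<alpha>]
  by clarsimp (metis dagger_dagger dagger_zero)

text \<open>\<open>dagger\<close> exchanges positive and negative root spaces and conjugates the
  eigenvalue of \<open>J\<close>; the two sign changes cancel. Consequently \<open>J\<close>
  preserves the compact form.\<close>

lemma J_dagger:
  assumes "X \<in> gC"
  shows "J (dagger X) = dagger (J X)"
proof (rule root_induct[OF assms])
  show "csubspace {X \<in> gC. J (dagger X) = dagger (J X)}"
    by (auto simp: csubspace_def gC_zero gC_add gC_cscale J_zero J_add J_cscale dagger_simps dagger_closed)
  show "J (dagger H) = dagger (J H)" if "H \<in> t" for H
    using that by (simp add: cartanD J_minus J_cartan)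
  show "J (dagger E) = dagger (J E)" if "\<alpha> \<in> \<Phi>" "E \<in> root_space gC t \<alpha>" for \<alpha> E
    using that(1)
  proof (cases rule: root_cases)
    case 1
    then show ?thesis
      using that J_pos[of \<alpha> E] J_neg[OF pos_root_negative dagger_root_space, of \<alpha> E]
      by (simp add: dagger_simps root_negative)
  next
    case 2
    then show ?thesis
      using that J_neg[of \<alpha> E] J_pos[OF neg_root_negative dagger_root_space, of \<alpha> E]
      by (simp add: dagger_simps)
  qed
qed

lemma J_compact_form: "X \<in> \<gg> \<Longrightarrow> J X \<in> \<gg>"
  using J_dagger[of X] by (simp add: compact_form_def J_closed J_minus)

lemma J_skew_root_cartan:
  assumes "\<alpha> \<in> \<Phi>" "E \<in> root_space gC t \<alpha>" "H \<in> t"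
  shows "trace (J E ** H) = 0" "trace (H ** J E) = 0"
proof -
  obtain H' where "H' \<in> t" "\<alpha> H' \<noteq> 0"
    using assms(1) by (auto simp: roots_def)
  then have "trace (E ** H) = 0"
    using trace_root_orthogonal[OF assms(2) cartan_root_space[OF assms(3)], of H'] by simp
  moreover obtain c where "J E = c *\<^sub>C E"
    using assms(1) by (cases rule: root_cases) (use J_pos J_neg assms(2) in blast)+
  ultimately show "trace (J E ** H) = 0"
    by (simp add: cscale_left trace_cscale)
  then show "trace (H ** J E) = 0"
    by (subst trace_mul_sym)
qed

text \<open>The trace of the product can be nonzero only for opposite roots, and on these
  \<open>J\<close> has opposite eigenvalues.\<close>

lemma J_skew_roots:
  assumes "\<alpha> \<in> \<Phi>" "X \<in> root_space gC t \<alpha>" "\<beta> \<in> \<Phi>" "Y \<in> root_space gC t \<beta>"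
  shows "trace (J X ** Y) = - trace (X ** J Y)"
proof (cases "\<exists>H\<in>t. \<alpha> H + \<beta> H \<noteq> 0")
  case True
  then have "trace (X ** Y) = 0"
    using trace_root_orthogonal assms by blast
  moreover obtain c where "J X = c *\<^sub>C X"
    using assms(1) by (cases rule: root_cases) (use J_pos J_neg assms(2) in blast)+
  moreover obtain d where "J Y = d *\<^sub>C Y"
    using assms(3) by (cases rule: root_cases) (use J_pos J_neg assms(4) in blast)+
  ultimately show ?thesis
    by (simp add: cscale_left cscale_right trace_cscale)
next
  case False
  have "\<beta> H = - \<alpha> H" for H
  proof (cases "H \<in> t")
    case True
    then show ?thesis
      using False by (simp add: add_eq_0_iff)
  next
    case False
    then show ?thesis
      using assms(1,3) by (simp add: roots_def)
  qed
  then have \<beta>: "\<beta> = (\<lambda>H. - \<alpha> H)"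
    by blast
  show ?thesis
    using assms(1)
  proof (cases rule: root_cases)
    case 1
    then show ?thesis
      using J_pos[OF 1 assms(2)] J_neg[OF pos_root_negative[OF 1], folded \<beta>] assms
      by (simp add: cscale_left cscale_right trace_cscale)
  next
    case 2
    then show ?thesis
      using J_neg[OF 2 assms(2)] J_pos[OF neg_root_negative[OF 2], folded \<beta>] assms
      by (simp add: cscale_left cscale_right trace_cscale)
  qed
qed

text \<open>Root induction in each of the two arguments.\<close>

lemma J_skew:
  assumes "X \<in> gC" "Y \<in> gC"
  shows "trace (J X ** Y) = - trace (X ** J Y)"
proof -
  have csub1: "csubspace {X \<in> gC. \<forall>Y\<in>S. trace (J X ** Y) = - trace (X ** J Y)}" for S
    by (auto simp: csubspace_def gC_zero gC_add gC_cscale J_zero J_add J_cscale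
        matrix_mult_simps trace_add cscale_left trace_cscale)
  have csub2: "csubspace {Y \<in> gC. trace (J X ** Y) = - trace (X ** J Y)}" for X
    by (auto simp: csubspace_def gC_zero gC_add gC_cscale J_zero J_add J_cscale
        matrix_mult_simps trace_add cscale_right trace_cscale)
  have "\<forall>Y\<in>gC. trace (J X ** Y) = - trace (X ** J Y)"
    using assms(1) csub1
  proof (rule root_induct)
    show "\<forall>Y\<in>gC. trace (J H ** Y) = - trace (H ** J Y)" if H: "H \<in> t" for H
    proof
      fix Y assume "Y \<in> gC"
      then show "trace (J H ** Y) = - trace (H ** J Y)"
        by (rule root_induct[OF _ csub2])
          (simp_all add: J_cartan H matrix_mult_simps J_skew_root_cartan)
    qed
    show "\<forall>Y\<in>gC. trace (J E ** Y) = - trace (E ** J Y)"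
      if E: "\<alpha> \<in> \<Phi>" "E \<in> root_space gC t \<alpha>" for \<alpha> E
    proof
      fix Y assume "Y \<in> gC"
      then show "trace (J E ** Y) = - trace (E ** J Y)"
        by (rule root_induct[OF _ csub2])
          (use E in \<open>simp_all add: J_cartan matrix_mult_simps J_skew_root_cartan J_skew_roots\<close>)
    qed
  qed
  then show ?thesis
    using assms(2) by blast
qed

lemma trform_J: "X \<in> gC \<Longrightarrow> Y \<in> gC \<Longrightarrow> trform (J X) Y = - trform X (J Y)"
  by (simp add: trform_def J_skew)

section \<open>The values of the roots on the grading element \<open>\<rho>\<close>\<close>

lemma h_sub_subset: "h_sub gC t \<Delta> \<phi> \<subseteq> \<gg>"
  unfolding h_sub_def by (rule span_minimal) (auto intro: cartanD subspace_compact_form)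

lemma cartan_subset_h_sub: "t \<subseteq> h_sub gC t \<Delta> \<phi>"
  unfolding h_sub_def by (meson Un_upper1 order_trans span_superset)

lemma rho_commutes: "X \<in> h_sub gC t \<Delta> \<phi> \<Longrightarrow> lie \<rho> X = 0"
  using rho_center by (simp add: lie_center_def)

text \<open>\<open>\<rho>\<close> commutes with \<open>t\<close>, a part of \<open>h_sub\<close>,
  and \<open>t\<close> is maximal abelian.\<close>

lemma rho_cartan: "\<rho> \<in> t"
proof (rule cartanD(5))
  show "\<rho> \<in> \<gg>"
    using rho_center h_sub_subset by (auto simp: lie_center_def)
  show "lie \<rho> H = 0" if "H \<in> t" for H
    using that cartan_subset_h_sub by (intro rho_commutes) blast
qed

lemmas rho_compact_form = cartanD(1)[OF rho_cartan] and rho_gC = cartanD(4)[OF rho_cartan]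

text \<open>\<open>h_sub\<close> contains both \<open>E - dagger E\<close> and
  \<open>\<i> *\<^sub>C (E + dagger E)\<close> for a root vector \<open>E\<close>. As
  \<open>\<rho>\<close> commutes with both, it commutes with \<open>E\<close>, on which it acts by
  \<open>\<delta> \<rho>\<close>.\<close>

lemma compact_simple_root_rho:
  assumes \<delta>: "\<delta> \<in> \<Delta>" "\<delta> \<noteq> \<phi>"
  shows "\<delta> \<rho> = 0"
proof -
  have "finite \<Delta>" "\<delta> \<in> \<Phi>"
    using simple \<delta> by (auto simp: simple_system_def)
  have "\<delta> = nat_comb \<Delta> (\<lambda>x. if x = \<delta> then 1 else 0)"
    using \<open>finite \<Delta>\<close> \<delta> by (simp add: nat_comb_def if_distrib[of of_nat] if_distrib[of "\<lambda>c. c * _"] cong: if_cong)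
  then have cpos: "\<delta> \<in> compact_pos_roots \<Phi> \<Delta> \<phi>"
    using \<open>\<delta> \<in> \<Phi>\<close> \<delta> by (auto simp: compact_pos_roots_def intro!: exI[of _ "\<lambda>x. if x = \<delta> then 1 else 0"])
  obtain E where E: "E \<in> root_space gC t \<delta>" "E \<noteq> 0"
    using \<open>\<delta> \<in> \<Phi>\<close> by (auto simp: roots_def)
  note E' = dagger_root_space[OF E(1)]
  have EgC: "E \<in> gC"
    using E by (simp add: root_spaceD)
  have in_h: "X \<in> h_sub gC t \<Delta> \<phi>"
    if "X = A + B" "A \<in> root_space gC t \<delta>" "B \<in> root_space gC t (\<lambda>H. - \<delta> H)" "X \<in> \<gg>" for X A B
    unfolding h_sub_def using that cpos by (intro span_base) blast
  have "E - dagger E \<in> h_sub gC t \<Delta> \<phi>"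
  proof (rule in_h)
    show "E - dagger E = E + (- 1) *\<^sub>C dagger E"
      by (simp add: cscale_minus_left)
    show "(- 1) *\<^sub>C dagger E \<in> root_space gC t (\<lambda>H. - \<delta> H)"
      using E' csubspace_root_space unfolding csubspace_def by blast
  qed (use E EgC skew_part in auto)
  moreover have "\<i> *\<^sub>C (E + dagger E) \<in> h_sub gC t \<Delta> \<phi>"
  proof (rule in_h)
    show "\<i> *\<^sub>C (E + dagger E) = \<i> *\<^sub>C E + \<i> *\<^sub>C dagger E"
      by (simp add: cscale_add_right)
    show "\<i> *\<^sub>C E \<in> root_space gC t \<delta>" "\<i> *\<^sub>C dagger E \<in> root_space gC t (\<lambda>H. - \<delta> H)"
      using E E' csubspace_root_space unfolding csubspace_def by blast+
  qed (use EgC i_herm_part in auto)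
  ultimately have "lie \<rho> (E - dagger E) = 0" "lie \<rho> (\<i> *\<^sub>C (E + dagger E)) = 0"
    by (auto intro: rho_commutes)
  then have "lie \<rho> E = lie \<rho> (dagger E)" "lie \<rho> E + lie \<rho> (dagger E) = 0"
    by (simp_all add: lie_simps cscale_add_right[symmetric])
  then have "lie \<rho> E + lie \<rho> E = 0"
    by simp
  then have "(2 * \<delta> \<rho>) *\<^sub>C E = 0"
    by (simp add: root_spaceD(2)[OF E(1) rho_cartan] flip: cscale_add_left)
  then show ?thesis
    using E by simp
qed

text \<open>Only \<open>\<phi>\<close> contributes at \<open>\<rho>\<close>, and its coefficient is
  0 or 1.\<close>

lemma pos_root_rho:
  assumes "\<alpha> \<in> pos_roots \<Phi> \<Delta>"
  shows "\<alpha> \<rho> = 0 \<or> \<alpha> \<rho> = \<i>"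
proof -
  obtain c where c: "\<alpha> = nat_comb \<Delta> c" "\<alpha> \<in> \<Phi>"
    using assms by (auto simp: pos_roots_def)
  have "finite \<Delta>" "\<phi> \<in> \<Delta>"
    using simple noncompact by (auto simp: simple_system_def noncompact_simple_root_def)
  have "\<alpha> \<rho> = (\<Sum>\<delta>\<in>\<Delta>. of_nat (c \<delta>) * \<delta> \<rho>)"
    using c(1) by (simp add: nat_comb_def)
  also have "\<dots> = (\<Sum>\<delta>\<in>\<Delta>. if \<delta> = \<phi> then of_nat (c \<phi>) * \<i> else 0)"
    by (rule sum.cong) (auto simp: compact_simple_root_rho phi_rho)
  also have "\<dots> = of_nat (c \<phi>) * \<i>"
    using \<open>finite \<Delta>\<close> \<open>\<phi> \<in> \<Delta>\<close> by simp
  finally show ?thesis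
    using noncompact c by (auto simp: noncompact_simple_root_def)
qed

text \<open>On the noncompact root spaces \<open>J\<close> agrees with \<open>ad \<rho>\<close>, and \<open>ad \<rho>\<close> kills the rest.\<close>

lemma J_ad_rho:
  assumes "X \<in> gC"
  shows "J (lie \<rho> X) = lie \<rho> (lie \<rho> X)"
proof (rule root_induct[OF assms])
  show "csubspace {X \<in> gC. J (lie \<rho> X) = lie \<rho> (lie \<rho> X)}"
    by (auto simp: csubspace_def gC_zero gC_add gC_cscale lie_closed rho_gC lie_simps J_zero J_add J_cscale)
  show "J (lie \<rho> H) = lie \<rho> (lie \<rho> H)" if "H \<in> t" for H
    using that by (simp add: cartanD rho_cartan J_zero lie_simps)
  show "J (lie \<rho> E) = lie \<rho> (lie \<rho> E)" if "\<alpha> \<in> \<Phi>" "E \<in> root_space gC t \<alpha>" for \<alpha> E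
  proof -
    note ad = root_spaceD(2)[OF that(2) rho_cartan]
    have EgC: "E \<in> gC"
      using that by (simp add: root_spaceD)
    show ?thesis
      using that(1)
    proof (cases rule: root_cases)
      case 1
      then show ?thesis
        using pos_root_rho[OF 1] by (auto simp: ad J_zero lie_simps J_cscale EgC J_pos[OF 1 that(2)])
    next
      case 2
      have "\<alpha> \<rho> = 0 \<or> \<alpha> \<rho> = - \<i>"
        using pos_root_rho[OF neg_root_negative[OF 2]] by (auto simp: neg_equal_iff_equal minus_equation_iff)
      then show ?thesis
        by (auto simp: ad J_zero lie_simps J_cscale EgC J_neg[OF 2 that(2)])
    qed
  qed
qed


section \<open>The Poisson-Lie structure\<close>

abbreviation "G \<equiv> conn_group \<gg>"

lemma G_unitary: "g \<in> G \<Longrightarrow> unitary g"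
  by (erule conn_group_unitary) (rule compact_formD(2))

lemma G_dagger: "g \<in> G \<Longrightarrow> dagger g \<in> G"
  by (erule conn_group_dagger[OF _ subspace_compact_form]) (rule compact_formD(2))

lemma Ad_G: "g \<in> G \<Longrightarrow> X \<in> gC \<Longrightarrow> Ad g X \<in> gC"
  by (simp add: Ad_unitary G_unitary Ad_closed)

lemma Ad_compact_form:
  assumes "g \<in> G" "X \<in> \<gg>"
  shows "Ad g X \<in> \<gg>"
proof (rule compact_formI)
  show "Ad g X \<in> gC"
    using assms by (simp add: Ad_G compact_formD)
  show "dagger (Ad g X) = - Ad g X"
    using assms(1) compact_formD(2)[OF assms(2)]
    by (simp add: Ad_unitary G_unitary dagger_simps matrix_mult_simps matrix_mul_assoc)
qed

lemma mu_Ad: "mu \<rho> g = Ad g \<rho>"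
  by (simp add: mu_def Ad_def)

lemma mu_compact_form: "g \<in> G \<Longrightarrow> mu \<rho> g \<in> \<gg>"
  by (simp add: mu_Ad Ad_compact_form rho_compact_form)

text \<open>The spaces \<open>\<gg>\<close> and \<open>b_minus\<close> meet only in 0: the equation
  exhibits \<open>\<i> *\<^sub>C Z\<close> as \<open>X + J Z\<close>, an element of
  \<open>\<gg>\<close>.\<close>

lemma C_minus_eq_compact_form:
  assumes "X \<in> \<gg>" "Z \<in> \<gg>" "C_minus J Z = X"
  shows "Z = 0" "X = 0"
proof -
  have "\<i> *\<^sub>C Z = X + J Z"
    using assms(3) by (auto simp: C_minus_def)
  then have "\<i> *\<^sub>C Z \<in> \<gg>"
    using assms by (simp add: J_compact_form subspace_add subspace_compact_form)
  then show "Z = 0"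
    using assms i_in_compact_form by blast
  then show "X = 0"
    using assms(3) by (simp add: C_minus_def J_zero)
qed

lemma C_minus_diff: "X \<in> gC \<Longrightarrow> Y \<in> gC \<Longrightarrow> C_minus J (X - Y) = C_minus J X - C_minus J Y"
  by (simp add: C_minus_def J_diff cscale_diff_right)

lemma decomposition_unique:
  assumes "X \<in> \<gg>" "Y \<in> \<gg>" "X' \<in> \<gg>" "Y' \<in> \<gg>"
    and eq: "X + C_minus J Y = X' + C_minus J Y'"
  shows "X = X'" "C_minus J Y = C_minus J Y'"
proof -
  have "C_minus J (Y - Y') = X' - X"
    using assms(2,4) eq by (simp add: C_minus_diff compact_formD algebra_simps)
  then have "X' - X = 0"
    using C_minus_eq_compact_form[of "X' - X" "Y - Y'"] assms subspace_compact_form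
    by (simp add: subspace_diff)
  then show "X = X'" "C_minus J Y = C_minus J Y'"
    using eq by simp_all
qed

lemma pr_g_eq: "X \<in> \<gg> \<Longrightarrow> Y \<in> \<gg> \<Longrightarrow> pr_g J \<gg> (X + C_minus J Y) = X"
  unfolding pr_g_def
proof (rule the_equality)
  fix X' assume X: "X \<in> \<gg>" "Y \<in> \<gg>" "X' \<in> \<gg> \<and> X + C_minus J Y - X' \<in> b_minus J \<gg>"
  then obtain Y' where "Y' \<in> \<gg>" "X + C_minus J Y = X' + C_minus J Y'"
    by (auto simp: b_minus_def algebra_simps)
  then show "X' = X"
    using decomposition_unique X by blast
qed (auto simp: b_minus_def)

lemma pr_b_eq: "X \<in> \<gg> \<Longrightarrow> Y \<in> \<gg> \<Longrightarrow> pr_b J \<gg> (X + C_minus J Y) = C_minus J Y"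
  unfolding pr_b_def
proof (rule the_equality)
  fix B assume X: "X \<in> \<gg>" "Y \<in> \<gg>" "B \<in> b_minus J \<gg> \<and> X + C_minus J Y - B \<in> \<gg>"
  then obtain Y' where "Y' \<in> \<gg>" "B = C_minus J Y'"
    by (auto simp: b_minus_def)
  moreover have "X + C_minus J Y = (X + C_minus J Y - B) + B"
    by simp
  ultimately show "B = C_minus J Y"
    using decomposition_unique X by metis
qed (auto simp: b_minus_def)

text \<open>The two signs from \<open>dagger\<close> cancel and the trace is cyclic. Under
  \<open>Im\<close> the summand \<open>J\<close> of \<open>C_minus\<close> thus drops out against an
  element of \<open>\<gg>\<close>.\<close>

lemma trace_compact_form_real: "X \<in> \<gg> \<Longrightarrow> Y \<in> \<gg> \<Longrightarrow> Im (trace (X ** Y)) = 0"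
proof -
  assume "X \<in> \<gg>" "Y \<in> \<gg>"
  then have "cnj (trace (X ** Y)) = trace (Y ** X)"
    by (simp add: trace_dagger[symmetric] dagger_mult compact_formD matrix_mult_simps)
  also have "\<dots> = trace (X ** Y)"
    by (rule trace_mul_sym)
  finally show ?thesis
    by (simp add: complex_eq_iff)
qed

text \<open>The operator \<open>J_g\<close> of the overview. It is a group coboundary of
  \<open>J\<close> and vanishes on \<open>gC\<close> at the identity, like the bivector that it
  encodes.\<close>

definition J_shift :: "complex^'n^'n \<Rightarrow> complex^'n^'n \<Rightarrow> complex^'n^'n" where
  "J_shift g X = Ad g (J (Ad (dagger g) X)) - J X"

lemma J_shift_compact_form: "g \<in> G \<Longrightarrow> X \<in> \<gg> \<Longrightarrow> J_shift g X \<in> \<gg>"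
  by (simp add: J_shift_def Ad_compact_form J_compact_form G_dagger subspace_diff subspace_compact_form)

text \<open>\<open>J\<close> and its conjugate by \<open>Ad g\<close> are both skew. This is what
  moves the operator between the differential of \<open>f\<close>, that of \<open>s\<close> and a
  tangent vector.\<close>

lemma J_shift_skew:
  assumes "g \<in> G" "X \<in> \<gg>" "Y \<in> \<gg>"
  shows "trform (J_shift g X) Y = - trform X (J_shift g Y)"
proof -
  have "trform (Ad g (J (Ad (dagger g) X))) Y = - trform (Ad (dagger g) X) (J (Ad (dagger g) Y))"
    using assms by (simp add: trform_Ad[symmetric] G_unitary trform_J compact_formD Ad_G G_dagger)
  also have "\<dots> = - trform X (Ad g (J (Ad (dagger g) Y)))"
    using trform_Ad[OF unitary_dagger[OF G_unitary[OF assms(1)]]] by simp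
  finally show ?thesis
    using assms by (simp add: J_shift_def trform.diff_left trform.diff_right trform_J compact_formD)
qed

lemma pi_G_eq:
  assumes g: "g \<in> G" and "\<xi> \<in> \<gg>" "\<eta> \<in> \<gg>"
  shows "pi_G J \<gg> g \<xi> \<eta> = trform (J_shift g \<xi>) \<eta>"
proof -
  have split: "Ad (matrix_inv g) (C_minus J X)
      = (J (Ad (dagger g) X) - Ad (dagger g) (J X)) + C_minus J (Ad (dagger g) X)" for X
    using g by (simp add: unitary_inv G_unitary C_minus_def Ad_linear)
  have closed: "J (Ad (dagger g) X) - Ad (dagger g) (J X) \<in> \<gg>" "Ad (dagger g) X \<in> \<gg>" if "X \<in> \<gg>" for X
    using g that by (simp_all add: Ad_compact_form J_compact_form G_dagger subspace_diff subspace_compact_form)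
  \<comment> \<open>\<open>Z\<close> is \<open>Ad (dagger g)\<close> of
    \<open>J_shift g \<xi>\<close>; invariance of the trace form undoes the conjugation at the
    end.\<close>
  define Z where "Z = J (Ad (dagger g) \<xi>) - Ad (dagger g) (J \<xi>)"
  have "pi_G J \<gg> g \<xi> \<eta> = Im (trace (Z ** C_minus J (Ad (dagger g) \<eta>)))"
    using closed assms(2,3) by (simp add: pi_G_def split pr_g_eq pr_b_eq Z_def)
  also have "\<dots> = trform Z (Ad (dagger g) \<eta>)"
    using closed assms(2,3) trace_compact_form_real[of Z "J (Ad (dagger g) \<eta>)"]
    by (simp add: C_minus_def matrix_mult_simps trace_sub cscale_right trace_cscale trform_def Z_def J_compact_form)
  also have "\<dots> = trform (J_shift g \<xi>) \<eta>"
    using g by (simp add: trform_Ad G_unitary Z_def J_shift_def Ad_linear Ad_dagger_cancel)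
  finally show ?thesis .
qed

text \<open>Conjugating back by \<open>g\<close> places tangent vectors in the image of
  \<open>lie \<rho>\<close>, where \<open>J\<close> acts as \<open>lie \<rho>\<close>. The sign in
  \<open>Y\<close> comes from the order of the bracket in \<open>tang\<close>.\<close>

lemma J_shift_tang:
  assumes g: "g \<in> G" and v: "v \<in> tang \<gg> (mu \<rho> g)"
  shows "J_shift g v = lie (mu \<rho> g) v - J v"
proof -
  obtain X where X: "X \<in> \<gg>" "v = lie X (mu \<rho> g)"
    using v by (auto simp: tang_def)
  define Y where "Y = - Ad (dagger g) X"
  have Y: "Y \<in> gC"
    using X(1) g by (simp add: Y_def gC_minus Ad_G G_dagger compact_formD)
  have "Ad (dagger g) v = lie (Ad (dagger g) X) \<rho>"
    using g by (simp add: X(2) Ad_lie unitary_dagger G_unitary mu_Ad Ad_dagger_cancel)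
  then have v': "Ad (dagger g) v = lie \<rho> Y"
    by (simp add: Y_def lie_simps lie_anticomm[of \<rho>])
  then have "Ad g (J (Ad (dagger g) v)) = Ad g (lie \<rho> (Ad (dagger g) v))"
    by (simp add: J_ad_rho Y)
  also have "\<dots> = lie (mu \<rho> g) v"
    using g by (simp add: Ad_lie G_unitary mu_Ad Ad_dagger_cancel)
  finally show ?thesis
    by (simp add: J_shift_def)
qed

end


section \<open>Differentials on the group and on the orbit\<close>

lemma Ck_on_const: "Ck_on k U (\<lambda>x. c)"
  by (induction k arbitrary: c) (simp_all add: frechet_derivative_const)

lemma Ck_on_bounded_linear:
  assumes "bounded_linear f"
  shows "Ck_on k U f"
proof (cases k)
  case 0
  then show ?thesis
    using assms by (simp add: linear_continuous_on)
next
  case (Suc k)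
  have "frechet_derivative f (at x) = f" for x
    using bounded_linear_imp_has_derivative[OF assms] by (metis frechet_derivative_at)
  then show ?thesis
    by (simp add: Suc Ck_on_const bounded_linear_imp_differentiable[OF assms])
qed

lemma smooth_near_bounded_linear: "bounded_linear f \<Longrightarrow> smooth_near M f"
  unfolding smooth_near_def by (intro exI[of _ UNIV]) (simp add: Ck_on_bounded_linear)

lemma smooth_near_differentiable:
  assumes "smooth_near M f" "x \<in> M"
  shows "f differentiable (at x)"
proof -
  obtain U where "M \<subseteq> U" "Ck_on (Suc 0) U f"
    using assms(1) unfolding smooth_near_def by blast
  then show ?thesis
    using assms(2) by auto
qed

lemma group_deriv_linear:
  assumes "linear s"
  shows "group_deriv X s g = s (X ** g)"
proof -
  have "((\<lambda>r. mexp (r *\<^sub>R X) ** g) has_vector_derivative (X ** mexp (0 *\<^sub>R X)) ** g) (at 0)"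
    by (rule bounded_linear.has_vector_derivative[OF matrix_mult.bounded_linear_left
          mexp_has_vector_derivative])
  then have "((\<lambda>r. s (mexp (r *\<^sub>R X) ** g)) has_vector_derivative s (X ** g)) (at 0)"
    using bounded_linear.has_vector_derivative[OF linear_conv_bounded_linear[THEN iffD1, OF assms]]
    by fastforce
  then show ?thesis
    unfolding group_deriv_def by (rule vector_derivative_at)
qed

text \<open>The cut-off outside the tangent space follows \<open>cotang\<close>; by
  \<open>cotang_trform\<close> every covector at a point of \<open>\<gg>\<close> has this
  form.\<close>

abbreviation trform_covector ::
    "(complex^'n^'n) set \<Rightarrow> complex^'n^'n \<Rightarrow> complex^'n^'n \<Rightarrow> complex^'n^'n \<Rightarrow> real" where
  "trform_covector \<gg> x X \<equiv> (\<lambda>v. if v \<in> tang \<gg> x then trform v X else 0)"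

lemma orbit_diff_trform: "orbit_diff \<gg> (\<lambda>y. trform y X) x = trform_covector \<gg> x X"
proof -
  have "((\<lambda>y. trform y X) has_derivative (\<lambda>y. trform y X)) (at x)"
    by (rule bounded_linear_imp_has_derivative[OF trform.bounded_linear_left])
  then have "frechet_derivative (\<lambda>y. trform y X) (at x) = (\<lambda>y. trform y X)"
    by (metis frechet_derivative_at)
  then show ?thesis
    by (auto simp: orbit_diff_def)
qed

lemma trform_lie_swap: "trform (lie x Y) X = trform Y (lie X x)"
  by (metis trform_commute trform_lie)

context hermitian_root_data
begin

section \<open>Gradients on the group and the contravariant derivative of a function\<close>

lemma group_diff_eq:
  assumes "\<xi> \<in> \<gg>" "\<And>X. X \<in> \<gg> \<Longrightarrow> trform \<xi> X = group_deriv X f g"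
  shows "group_diff \<gg> f g = \<xi>"
  unfolding group_diff_def
proof (rule the_equality)
  fix \<xi>' assume \<xi>': "\<xi>' \<in> \<gg> \<and> (\<forall>X\<in>\<gg>. trform \<xi>' X = group_deriv X f g)"
  then have "\<xi>' - \<xi> = 0"
    using assms subspace_compact_form
    by (intro trform_separates) (auto simp: subspace_diff trform.diff_left)
  then show "\<xi>' = \<xi>"
    by simp
qed (use assms in blast)

text \<open>Along the curve, \<open>mu\<close> is conjugated by \<open>mexp (s *\<^sub>R X)\<close>,
  and the product rule at \<open>s = 0\<close> gives the commutator.\<close>

lemma group_deriv_mu:
  assumes g: "g \<in> G" and X: "X \<in> \<gg>" and f: "f differentiable (at (mu \<rho> g))"
  shows "group_deriv X (\<lambda>g'. f (mu \<rho> g')) g = frechet_derivative f (at (mu \<rho> g)) (lie X (mu \<rho> g))"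
proof -
  have mu_eq: "mu \<rho> (mexp (s *\<^sub>R X) ** g) = mexp (s *\<^sub>R X) ** (mu \<rho> g ** mexp (s *\<^sub>R (- X)))" for s
  proof -
    have sX: "s *\<^sub>R X \<in> \<gg>"
      using X by (simp add: subspace_scale subspace_compact_form)
    then have "mexp (s *\<^sub>R X) ** g \<in> G"
      using g by (rule conn_group.step)
    then show ?thesis
      using g compact_formD(2)[OF sX]
      by (simp add: mu_Ad Ad_unitary G_unitary dagger_mult dagger_mexp matrix_mul_assoc)
  qed
  have "((\<lambda>s. mexp (s *\<^sub>R X) ** (mu \<rho> g ** mexp (s *\<^sub>R (- X)))) has_vector_derivative
      mexp (0 *\<^sub>R X) ** (mu \<rho> g ** ((- X) ** mexp (0 *\<^sub>R (- X))))
      + (X ** mexp (0 *\<^sub>R X)) ** (mu \<rho> g ** mexp (0 *\<^sub>R (- X)))) (at 0)"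
    by (intro bounded_bilinear.has_vector_derivative[OF bounded_bilinear_matrix_mult]
        bounded_linear.has_vector_derivative[OF matrix_mult.bounded_linear_right]
        mexp_has_vector_derivative)
  then have d: "((\<lambda>s. mu \<rho> (mexp (s *\<^sub>R X) ** g)) has_vector_derivative lie X (mu \<rho> g)) (at 0)"
    by (simp add: mu_eq lie_def matrix_mult.minus_left matrix_mult.minus_right)
  have "(f has_derivative frechet_derivative f (at (mu \<rho> g))) (at (mu \<rho> (mexp (0 *\<^sub>R X) ** g)))"
    using f frechet_derivative_works[of f] by simp
  from vector_derivative_diff_chain_within[OF d has_derivative_at_withinI[OF this]]
  show ?thesis
    unfolding group_deriv_def o_def by (rule vector_derivative_at)
qed

lemma tang_separates:
  assumes "g \<in> G" "w \<in> tang \<gg> (mu \<rho> g)" "w' \<in> tang \<gg> (mu \<rho> g)"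
    and "\<And>Y. Y \<in> \<gg> \<Longrightarrow> trform w Y = trform w' Y"
  shows "w = w'"
proof -
  have "w \<in> \<gg>" "w' \<in> \<gg>"
    using assms tang_subset[OF mu_compact_form] by auto
  then have "w - w' = 0"
    using assms(4) subspace_compact_form
    by (intro trform_separates) (auto simp: subspace_diff trform.diff_left)
  then show ?thesis
    by simp
qed

lemma nabla_comp_eq:
  assumes g: "g \<in> G" and \<xi>: "\<xi> \<in> \<gg>" "\<And>X. X \<in> \<gg> \<Longrightarrow> trform \<xi> X = group_deriv X s g"
  shows "nabla_comp J \<gg> \<rho> s g = lie (J_shift g \<xi>) (mu \<rho> g)"
proof -
  define x where "x = mu \<rho> g"
  define w where "w = lie (J_shift g \<xi>) x"
  have x: "x \<in> \<gg>" "x \<in> orbit \<gg> \<rho>"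
    using g by (auto simp: x_def mu_compact_form orbit_def)
  have w: "w \<in> tang \<gg> x"
    using J_shift_compact_form[OF g \<xi>(1)] by (auto simp: w_def tang_def)
  have ok: "orbit_diff \<gg> f x w = - bracket_G J \<gg> (\<lambda>g'. f (mu \<rho> g')) s g"
    if f: "smooth_near (orbit \<gg> \<rho>) f" for f :: "complex^'n^'n \<Rightarrow> real"
  proof -
    define D where "D = frechet_derivative f (at x)"
    have diff: "f differentiable (at x)"
      using f x(2) by (rule smooth_near_differentiable)
    then have "linear D"
      unfolding D_def by (rule linear_frechet_derivative)
    then obtain \<eta> where \<eta>: "\<eta> \<in> \<gg>" "\<And>X. X \<in> \<gg> \<Longrightarrow> trform \<eta> X = D X"
      using trform_represent by blast
    have grad: "group_diff \<gg> (\<lambda>g'. f (mu \<rho> g')) g = lie x \<eta>"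
    proof (rule group_diff_eq)
      show "lie x \<eta> \<in> \<gg>"
        using x(1) \<eta>(1) by (rule compact_form_lie)
      show "trform (lie x \<eta>) X = group_deriv X (\<lambda>g'. f (mu \<rho> g')) g" if "X \<in> \<gg>" for X
        using group_deriv_mu[OF g that, of f] diff \<eta>(2)[of "lie X x"] that x(1)
        by (simp add: trform_lie_swap compact_form_lie D_def x_def)
    qed
    have "group_diff \<gg> s g = \<xi>"
      using \<xi> by (rule group_diff_eq)
    then have "bracket_G J \<gg> (\<lambda>g'. f (mu \<rho> g')) s g = pi_G J \<gg> g (lie x \<eta>) \<xi>"
      by (simp add: bracket_G_def grad)
    also have "\<dots> = trform (J_shift g (lie x \<eta>)) \<xi>"
      using g \<xi>(1) x(1) \<eta>(1) by (intro pi_G_eq compact_form_lie)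
    \<comment> \<open>Skewness moves \<open>J_shift g\<close> to \<open>\<xi>\<close> and invariance
      of the trace form collects the bracket with \<open>x\<close> there; the sign cancels the one
      in the definition of the connection.\<close>
    also have "\<dots> = - trform \<eta> w"
      using g \<xi>(1) x(1) \<eta>(1) by (simp add: J_shift_skew compact_form_lie trform_lie_swap w_def)
    finally show ?thesis
      using w \<eta>(2)[of w] tang_subset[OF x(1)] by (auto simp: orbit_diff_def D_def)
  qed
  \<comment> \<open>The functions \<open>trform y Y\<close>, linear in \<open>y\<close> and hence
    smooth, already separate tangent vectors.\<close>
  have unique: "w' = w" if w': "w' \<in> tang \<gg> x"
    and all: "\<And>f :: complex^'n^'n \<Rightarrow> real. smooth_near (orbit \<gg> \<rho>) f \<Longrightarrow>
      orbit_diff \<gg> f x w' = orbit_diff \<gg> f x w" for w'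
    unfolding x_def
  proof (rule tang_separates[OF g])
    show "w' \<in> tang \<gg> (mu \<rho> g)" "w \<in> tang \<gg> (mu \<rho> g)"
      using w w' by (simp_all add: x_def)
    show "trform w' Y = trform w Y" for Y
      using all[of "\<lambda>y. trform y Y"] w w'
      by (simp add: smooth_near_bounded_linear trform.bounded_linear_left orbit_diff_trform)
  qed
  show ?thesis
    unfolding nabla_comp_def x_def[symmetric] w_def[symmetric]
  proof (rule the_equality)
    fix w' assume w': "w' \<in> tang \<gg> x \<and> (\<forall>f :: complex^'n^'n \<Rightarrow> real. smooth_near (orbit \<gg> \<rho>) f \<longrightarrow>
      orbit_diff \<gg> f x w' = - bracket_G J \<gg> (\<lambda>g'. f (mu \<rho> g')) s g)"
    show "w' = w"
    proof (rule unique)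
      show "w' \<in> tang \<gg> x"
        using w' ..
      show "orbit_diff \<gg> f x w' = orbit_diff \<gg> f x w"
        if "smooth_near (orbit \<gg> \<rho>) f" for f :: "complex^'n^'n \<Rightarrow> real"
        using w' ok[OF that] that by (simp del: split_paired_All)
    qed
  qed (use w ok in blast)
qed

section \<open>Covectors of the orbit and inversion of the KKS bivector\<close>

lemma trform_covector_cotang:
  "trform_covector \<gg> x X \<in> cotang \<gg> x"
  using subspace_tang[of x]
  by (simp add: cotang_def trform.add_left trform.scaleR_left subspace_add subspace_scale)

lemma cotang_trform:
  assumes "x \<in> \<gg>" "a \<in> cotang \<gg> x"
  obtains X where "X \<in> \<gg>" "a = trform_covector \<gg> x X"
proof -
  obtain X where X: "X \<in> tang \<gg> x" "\<And>v. v \<in> tang \<gg> x \<Longrightarrow> trform X v = a v"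
    using trform_represent_subspace[OF subspace_tang tang_subset[OF assms(1)], of a] assms(2)
    by (auto simp: cotang_def)
  have "a = trform_covector \<gg> x X"
    using X(2) assms(2) by (auto simp: cotang_def trform_commute[of _ X])
  then show ?thesis
    using that X(1) tang_subset[OF assms(1)] by blast
qed

text \<open>\<open>is_kks\<close> prescribes \<open>P\<close> on differentials of linear functions
  only, but these exhaust the covectors. Invariance rewrites the prescribed value as the pairing of
  \<open>lie (mu \<rho> g) X\<close> with \<open>Y\<close>.\<close>

lemma sharp_eq:
  assumes P: "is_kks \<gg> \<rho> P" and g: "g \<in> G" and X: "X \<in> \<gg>"
  shows "sharp \<gg> P (mu \<rho> g) (trform_covector \<gg> (mu \<rho> g) X) = lie (mu \<rho> g) X"
  unfolding sharp_def
proof (rule the_equality)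
  let ?x = "mu \<rho> g"
  have P': "P ?x (trform_covector \<gg> ?x X) (trform_covector \<gg> ?x Y) = trform (lie ?x X) Y"
    if "Y \<in> \<gg>" for Y
    using P g X that by (auto simp: is_kks_def orbit_def orbit_diff_trform trform_lie)
  have tang: "lie ?x X \<in> tang \<gg> ?x"
    using X by (rule lie_in_tang)
  show "lie ?x X \<in> tang \<gg> ?x \<and> (\<forall>b\<in>cotang \<gg> ?x. b (lie ?x X) = P ?x (trform_covector \<gg> ?x X) b)"
  proof (intro conjI ballI tang)
    fix b assume b: "b \<in> cotang \<gg> ?x"
    obtain Y where "Y \<in> \<gg>" "b = trform_covector \<gg> ?x Y"
      by (rule cotang_trform[OF mu_compact_form[OF g] b])
    then show "b (lie ?x X) = P ?x (trform_covector \<gg> ?x X) b"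
      using P' tang by simp
  qed
  fix w assume w: "w \<in> tang \<gg> ?x \<and> (\<forall>b\<in>cotang \<gg> ?x. b w = P ?x (trform_covector \<gg> ?x X) b)"
  show "w = lie ?x X"
  proof (rule tang_separates[OF g _ tang])
    show "trform w Y = trform (lie ?x X) Y" if "Y \<in> \<gg>" for Y
    proof -
      have "trform_covector \<gg> ?x Y w = P ?x (trform_covector \<gg> ?x X) (trform_covector \<gg> ?x Y)"
        by (rule bspec[OF conjunct2[OF w] trform_covector_cotang])
      then show ?thesis
        using w by (simp only: P'[OF that] if_True)
    qed
  qed (use w in blast)
qed

text \<open>For injectivity: the pairing of \<open>lie Z x\<close> with \<open>Y\<close> is that of
  \<open>Z\<close> with \<open>lie x Y\<close>, so the covector of \<open>Y\<close> depends only on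
  \<open>lie x Y\<close>.\<close>

lemma Omega_eq:
  assumes P: "is_kks \<gg> \<rho> P" and g: "g \<in> G" and X: "X \<in> \<gg>"
  shows "Omega \<gg> P (mu \<rho> g) (lie (mu \<rho> g) X) = trform_covector \<gg> (mu \<rho> g) X"
  unfolding Omega_def
proof (rule the_equality)
  let ?x = "mu \<rho> g"
  show "trform_covector \<gg> ?x X \<in> cotang \<gg> ?x \<and> sharp \<gg> P ?x (trform_covector \<gg> ?x X) = lie ?x X"
    using trform_covector_cotang sharp_eq[OF assms] by blast
  fix a assume a: "a \<in> cotang \<gg> ?x \<and> sharp \<gg> P ?x a = lie ?x X"
  then have "a \<in> cotang \<gg> ?x" ..
  then obtain Y where Y: "Y \<in> \<gg>" "a = trform_covector \<gg> ?x Y"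
    by (rule cotang_trform[OF mu_compact_form[OF g]])
  have eq: "lie ?x Y = lie ?x X"
    using a unfolding Y(2) sharp_eq[OF P g Y(1)] ..
  have "trform v Y = trform v X" if "v \<in> tang \<gg> ?x" for v
    using that eq by (auto simp: tang_def trform_lie)
  then show "a = trform_covector \<gg> ?x X"
    using Y(2) by auto
qed

text \<open>\<open>\<xi>\<close> is the gradient of \<open>s\<close> at \<open>g\<close>. Once
  skewness has moved \<open>J_shift g\<close> to \<open>v\<close>, pairing with \<open>\<xi>\<close>
  is evaluation of \<open>s\<close>, and \<open>\<xi>\<close> disappears.\<close>

lemma Omega_nabla_comp:
  assumes P: "is_kks \<gg> \<rho> P" and g: "g \<in> G" and v: "v \<in> tang \<gg> (mu \<rho> g)" and s: "linear s"
  shows "Omega \<gg> P (mu \<rho> g) (nabla_comp J \<gg> \<rho> s g) v = s ((lie (mu \<rho> g) v - J v) ** g)"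
proof -
  let ?x = "mu \<rho> g"
  have "linear (\<lambda>X. s (X ** g))"
    using linear_compose[OF bounded_linear.linear[OF matrix_mult.bounded_linear_left] s]
    by (simp add: o_def)
  then obtain \<xi> where \<xi>: "\<xi> \<in> \<gg>" "\<And>X. X \<in> \<gg> \<Longrightarrow> trform \<xi> X = s (X ** g)"
    using trform_represent by blast
  define W where "W = J_shift g \<xi>"
  have W: "- W \<in> \<gg>"
    using J_shift_compact_form[OF g \<xi>(1)] by (simp add: W_def subspace_neg subspace_compact_form)
  have vg: "v \<in> \<gg>"
    using v tang_subset[OF mu_compact_form[OF g]] by blast
  have "nabla_comp J \<gg> \<rho> s g = lie W ?x"
    unfolding W_def using g \<xi> by (intro nabla_comp_eq) (simp_all add: group_deriv_linear s)
  also have "\<dots> = lie ?x (- W)"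
    by (simp add: lie_def matrix_mult_simps)
  finally have "Omega \<gg> P ?x (nabla_comp J \<gg> \<rho> s g) v = trform v (- W)"
    using v by (simp add: Omega_eq[OF P g W])
  also have "\<dots> = trform (J_shift g v) \<xi>"
    using J_shift_skew[OF g vg \<xi>(1)] by (simp add: W_def trform.minus_right)
  also have "\<dots> = s (J_shift g v ** g)"
    using \<xi>(2)[OF J_shift_compact_form[OF g vg]] by (simp add: trform_commute)
  finally show ?thesis
    by (simp add: J_shift_tang[OF g v])
qed

text \<open>Stated for any linear \<open>F\<close>, so that one computation serves
  \<open>in_basis U\<close>, \<open>sigma_plus U\<close> and \<open>sigma_minus U\<close>.\<close>

lemma nabla_N_rows_linear:
  fixes F :: "complex^'n^'n \<Rightarrow> complex^'k^'r"
  assumes P: "is_kks \<gg> \<rho> P" and g: "g \<in> G" and v: "v \<in> tang \<gg> (mu \<rho> g)" and F: "linear F"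
  shows "nabla_N_rows J \<gg> \<rho> P F g v = F ((lie (mu \<rho> g) v - J v) ** g)"
proof -
  have "linear (\<lambda>g. Re (F g $ i $ j))" "linear (\<lambda>g. Im (F g $ i $ j))" for i j
    using F by (simp_all add: linear_iff)
  then show ?thesis
    by (simp add: nabla_N_rows_def nabla_N_def Omega_nabla_comp[OF P g v] vec_eq_iff)
qed

end


section \<open>The classical Lie algebras\<close>

lemma transpose_simps:
  "transpose (A + B) = transpose A + transpose B"
  "transpose (A - B) = transpose A - transpose B"
  "transpose (c *\<^sub>C A) = c *\<^sub>C transpose A"
  "transpose (0 :: complex^'n^'m) = 0"
  by (simp_all add: transpose_def vec_eq_iff cscale_def)

lemma transpose_dagger: "transpose (dagger A) = dagger (transpose A)"
  by (simp add: transpose_def dagger_def vec_eq_iff)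

lemma dagger_lie_algebra_sl: "dagger_lie_algebra (sl_algebra :: (complex^'n^'n) set)"
proof
  show "lie X Y \<in> sl_algebra" for X Y :: "complex^'n^'n"
    using trace_mul_sym[of X Y] by (simp add: sl_algebra_def lie_def trace_sub)
qed (simp_all add: csubspace_def sl_algebra_def trace_add trace_cscale trace_dagger)

text \<open>Moving \<open>S\<close> across a product of two elements costs two signs, which cancel,
  and transposition restores the order. For \<open>dagger\<close>, unitarity of \<open>S\<close>
  solves the condition for \<open>transpose X\<close>, and the adjoint of that equation is the
  condition for \<open>dagger X\<close>.\<close>

lemma dagger_lie_algebra_form:
  assumes S: "unitary S"
  shows "dagger_lie_algebra (form_algebra S)"
proof
  have iff: "X \<in> form_algebra S \<longleftrightarrow> S ** X = - (transpose X ** S)" for X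
    by (auto simp: form_algebra_def eq_neg_iff_add_eq_0 add.commute)
  show "csubspace (form_algebra S)"
    by (auto simp: csubspace_def iff transpose_simps matrix_mult_simps cscale_left cscale_right cscale_minus_right)
  show "lie X Y \<in> form_algebra S" if X: "X \<in> form_algebra S" and Y: "Y \<in> form_algebra S" for X Y
  proof -
    have "S ** A ** B = transpose A ** transpose B ** S"
      if "A \<in> form_algebra S" "B \<in> form_algebra S" for A B
    proof -
      have "S ** A ** B = - (transpose A ** (S ** B))"
        using that(1) by (simp add: iff matrix_mult_simps matrix_mul_assoc)
      also have "\<dots> = transpose A ** transpose B ** S"
        using that(2) by (simp add: iff matrix_mult_simps matrix_mul_assoc)
      finally show ?thesis .
    qed
    from this[OF X Y] this[OF Y X] show ?thesis
      by (simp add: iff lie_def matrix_mult_simps transpose_simps matrix_transpose_mul matrix_mul_assoc)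
  qed
  show "dagger X \<in> form_algebra S" if "X \<in> form_algebra S" for X
  proof -
    have "transpose X = transpose X ** S ** dagger S"
      using S by (simp add: mult_unitary_cancel)
    also have "\<dots> = - (S ** X ** dagger S)"
      using that by (simp add: iff matrix_mult_simps)
    finally have "transpose (dagger X) = - (S ** dagger X ** dagger S)"
      by (simp add: transpose_dagger dagger_simps matrix_mul_assoc)
    then show ?thesis
      using S by (simp add: iff matrix_mult_simps mult_unitary_cancel)
  qed
qed

text \<open>\<open>S\<close> intertwines \<open>X\<close> with \<open>- transpose X\<close>, so the
  two exponentials on either side of \<open>S\<close> are inverse to each other.\<close>

lemma conn_group_form:
  assumes "g \<in> conn_group K" "K \<subseteq> form_algebra S"
  shows "transpose g ** S ** g = S"
  using assms(1)
proof (induction rule: conn_group.induct)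
  case one
  then show ?case
    by (simp add: transpose_mat)
next
  case (step X g)
  have "S ** X = (- transpose X) ** S"
    using step.hyps(1) assms(2) by (auto simp: form_algebra_def matrix_mult_simps eq_neg_iff_add_eq_0 add.commute)
  then have "transpose (mexp X) ** (S ** mexp X) = mexp (transpose X) ** (mexp (- transpose X) ** S)"
    by (simp add: mexp_intertwine transpose_mexp)
  also have "\<dots> = S"
    by (simp add: matrix_mul_assoc mexp_minus)
  finally have "transpose g ** (transpose (mexp X) ** (S ** mexp X)) ** g = S"
    using step.IH by simp
  then show ?case
    by (simp add: matrix_transpose_mul matrix_mul_assoc)
qed

lemma classical_dagger_lie_algebra: "classical gC \<Longrightarrow> dagger_lie_algebra gC"
  unfolding classical_def using dagger_lie_algebra_sl dagger_lie_algebra_form by blast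

text \<open>For a form algebra, \<open>g\<close> preserves \<open>S\<close> and is unitary, so the
  defining expression of \<open>g ** X ** dagger g\<close> is that of \<open>X\<close> multiplied by
  invertible matrices on both sides.\<close>

lemma classical_Ad_closed:
  assumes "classical gC" and g: "g \<in> conn_group (compact_form gC)" and X: "X \<in> gC"
  shows "g ** X ** dagger g \<in> gC"
proof -
  have u: "unitary g"
    using g by (rule conn_group_unitary) (simp add: compact_form_def)
  consider "gC = sl_algebra" | S where "gC = form_algebra S"
    using assms(1) unfolding classical_def by blast
  then show ?thesis
  proof cases
    case 1
    have "trace (g ** X ** dagger g) = trace (dagger g ** (g ** X))"
      by (rule trace_mul_sym)
    also have "\<dots> = trace X"
      using u by (simp add: matrix_mul_assoc unitary_def)
    finally show ?thesis
      using 1 X by (simp add: sl_algebra_def)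
  next
    case 2
    have "transpose g ** S ** g = S"
      using g by (rule conn_group_form) (auto simp: 2 compact_form_def)
    then have gS: "transpose g ** S = S ** dagger g"
      using mult_unitary_cancel(1)[OF u] by metis
    have tu: "transpose (dagger g) ** transpose g = mat 1"
      using u by (simp add: unitary_def transpose_mat flip: matrix_transpose_mul)
    have Sg: "S ** g = transpose (dagger g) ** S"
    proof -
      have "S ** g = transpose (dagger g) ** (transpose g ** S) ** g"
        by (simp add: matrix_mul_assoc tu)
      also have "\<dots> = transpose (dagger g) ** S"
        using u by (simp add: gS matrix_mul_assoc mult_unitary_cancel)
      finally show ?thesis .
    qed
    have "transpose (g ** X ** dagger g) ** S = transpose (dagger g) ** (transpose X ** (transpose g ** S))"
      by (simp add: matrix_transpose_mul matrix_mul_assoc)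
    moreover have "S ** (g ** X ** dagger g) = (S ** g) ** (X ** dagger g)"
      by (simp add: matrix_mul_assoc)
    ultimately have "transpose (g ** X ** dagger g) ** S + S ** (g ** X ** dagger g)
        = transpose (dagger g) ** (transpose X ** S + S ** X) ** dagger g"
      by (simp add: gS Sg matrix_mult_simps matrix_mul_assoc)
    then show ?thesis
      using X by (simp add: 2 form_algebra_def matrix_mult.zero_left matrix_mult.zero_right)
  qed
qed


section \<open>Adapted bases\<close>

lemma in_basis_mult: "unitary U \<Longrightarrow> in_basis U (A ** B) = in_basis U A ** in_basis U B"
  by (simp add: in_basis_def matrix_mul_assoc mult_unitary_cancel)

lemma linear_in_basis: "linear (in_basis U)"
  by (simp add: linear_iff in_basis_def matrix_mult_simps)

lemma linear_sigma_plus: "linear (sigma_plus U)"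
  using linear_in_basis[of U] by (simp add: linear_iff sigma_plus_def vec_eq_iff)

lemma linear_sigma_minus: "linear (sigma_minus U)"
  using linear_in_basis[of U] by (simp add: linear_iff sigma_minus_def vec_eq_iff)

lemma matrix_mult_nth: "(A ** B) $ i $ j = (\<Sum>k\<in>UNIV. A $ i $ k * B $ k $ j)"
  by (simp add: matrix_matrix_mult_def)

lemma sigma_mult:
  assumes "unitary U"
  shows "sigma_plus U (A ** B) = in_basis U A ** sigma_plus U B"
    "sigma_minus U (A ** B) = in_basis U A ** sigma_minus U B"
  by (simp_all add: sigma_plus_def sigma_minus_def in_basis_mult[OF assms] vec_eq_iff matrix_mult_nth)

lemma in_basis_diagonal:
  assumes U: "unitary U" and eigen: "\<And>b. M *v column b U = e b *s column b U"
  shows "in_basis U M $ a $ b = (if a = b then e b else 0)"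
proof -
  have "in_basis U M $ a $ b = (dagger U ** (M ** U)) $ a $ b"
    by (simp add: in_basis_def matrix_mul_assoc)
  also have "\<dots> = (\<Sum>i\<in>UNIV. dagger U $ a $ i * (M *v column b U) $ i)"
    by (simp add: matrix_matrix_mult_def matrix_vector_mult_def column_def)
  also have "\<dots> = e b * (dagger U ** U) $ a $ b"
    unfolding eigen by (simp add: matrix_matrix_mult_def column_def sum_distrib_left mult_ac)
  finally show ?thesis
    using U by (simp add: unitary_def mat_def)
qed

text \<open>Used with two diagonal matrices: the exponential of \<open>pi *\<^sub>R \<rho>\<close>,
  to see that \<open>H\<close> is block diagonal, and \<open>\<rho>\<close> itself, for the
  eigenbundles.\<close>

lemma in_basis_lie_diagonal:
  assumes U: "unitary U" and eigen: "\<And>b. M *v column b U = e b *s column b U"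
  shows "in_basis U (lie M X) $ a $ b = (e a - e b) * in_basis U X $ a $ b"
proof -
  have "in_basis U (lie M X) = in_basis U M ** in_basis U X - in_basis U X ** in_basis U M"
    by (simp add: lie_def linear_diff[OF linear_in_basis] in_basis_mult[OF U])
  moreover have "(in_basis U M ** in_basis U X) $ a $ b = e a * in_basis U X $ a $ b"
    "(in_basis U X ** in_basis U M) $ a $ b = e b * in_basis U X $ a $ b"
    by (simp_all add: matrix_mult_nth in_basis_diagonal[OF assms] if_distrib[of "\<lambda>x. x * _"]
        if_distrib[of "\<lambda>x. _ * x"] cong: if_cong)
  ultimately show ?thesis
    by (simp add: left_diff_distrib)
qed

section \<open>Block form of \<open>H\<close> and equivariance of the tautological sections\<close>

lemma sum_UNIV_sum:
  "(\<Sum>x\<in>UNIV. f x) = (\<Sum>i\<in>UNIV. f (Inl i)) + (\<Sum>j\<in>UNIV. f (Inr j))"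
  for f :: "'a::finite + 'b::finite \<Rightarrow> 'c::comm_monoid_add"
  using sum.Plus[of "UNIV :: 'a set" "UNIV :: 'b set" f] by (simp add: o_def)

text \<open>Two applications of \<open>mexp_intertwine\<close> exponentiate the two commuting
  elements one after the other.\<close>

lemma center_commutes_mexp:
  assumes "\<rho> \<in> lie_center K" "h \<in> conn_group K"
  shows "mexp (r *\<^sub>R \<rho>) ** h = h ** mexp (r *\<^sub>R \<rho>)"
  using assms(2)
proof (induction rule: conn_group.induct)
  case (step X g)
  have "lie \<rho> X = 0"
    using assms(1) step.hyps(1) by (simp add: lie_center_def)
  then have "X ** (r *\<^sub>R \<rho>) = (r *\<^sub>R \<rho>) ** X"
    by (simp add: lie_def matrix_mult_simps)
  then have "mexp (r *\<^sub>R \<rho>) ** X = X ** mexp (r *\<^sub>R \<rho>)"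
    by (rule mexp_intertwine[symmetric])
  then have "mexp (r *\<^sub>R \<rho>) ** mexp X = mexp X ** mexp (r *\<^sub>R \<rho>)"
    by (rule mexp_intertwine)
  then have "mexp (r *\<^sub>R \<rho>) ** (mexp X ** g) = mexp X ** (mexp (r *\<^sub>R \<rho>) ** g)"
    by (simp add: matrix_mul_assoc)
  then show ?case
    by (simp add: step.IH matrix_mul_assoc)
qed simp

text \<open>An off-diagonal entry of the vanishing commutator is the entry of \<open>h\<close> times
  the difference of the eigenvalues \<open>cis k\<close> and \<open>- cis k\<close>, which is
  nonzero.\<close>

lemma adapted_block_diagonal:
  fixes U :: "complex^('p::finite + 'm::finite)^'n"
  assumes U: "adapted_basis \<rho> k U" and comm: "mexp (pi *\<^sub>R \<rho>) ** h = h ** mexp (pi *\<^sub>R \<rho>)"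
  shows "in_basis U h $ Inl i $ Inr j = 0" "in_basis U h $ Inr j $ Inl i = 0"
proof -
  define e :: "'p + 'm \<Rightarrow> complex" where "e = case_sum (\<lambda>_. cis k) (\<lambda>_. - cis k)"
  have u: "unitary U"
    using U by (simp add: adapted_basis_def)
  have "mexp (pi *\<^sub>R \<rho>) *v column b U = e b *s column b U" for b
    using U by (cases b) (auto simp: adapted_basis_def V_plus_def V_minus_def e_def)
  from in_basis_lie_diagonal[OF u this]
  have "(e a - e b) * in_basis U h $ a $ b = 0" for a b
    using comm linear_0[OF linear_in_basis[of U]] by (metis lie_def right_minus_eq zero_index)
  from this[of "Inl i" "Inr j"] this[of "Inr j" "Inl i"]
  show "in_basis U h $ Inl i $ Inr j = 0" "in_basis U h $ Inr j $ Inl i = 0"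
    by (simp_all add: e_def)
qed

text \<open>With the off-diagonal blocks of \<open>h\<close> gone, right multiplication by
  \<open>h\<close> acts on each column block through its own diagonal block.\<close>

lemma sigma_sections:
  fixes U :: "complex^('p::finite + 'm::finite)^'n"
  assumes U: "adapted_basis \<rho> k U"
    and comm: "\<And>h. h \<in> H \<Longrightarrow> mexp (pi *\<^sub>R \<rho>) ** h = h ** mexp (pi *\<^sub>R \<rho>)"
  shows "is_section G H (R_plus U) (\<lambda>g. sigma_plus U g $ i)"
    and "is_section G H (R_minus U) (\<lambda>g. sigma_minus U g $ i)"
proof -
  have u: "unitary U"
    using U by (simp add: adapted_basis_def)
  have "sigma_plus U (g ** h) $ i = sigma_plus U g $ i v* R_plus U h"
    "sigma_minus U (g ** h) $ i = sigma_minus U g $ i v* R_minus U h" if "h \<in> H" for g h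
    using adapted_block_diagonal[OF U comm[OF that]]
    by (simp_all add: sigma_plus_def sigma_minus_def R_plus_def R_minus_def in_basis_mult[OF u]
        vec_eq_iff matrix_mult_nth vector_matrix_mult_def sum_UNIV_sum mult_ac)
  moreover have "bounded_linear (\<lambda>g. sigma_plus U g $ i)" "bounded_linear (\<lambda>g. sigma_minus U g $ i)"
    using linear_sigma_plus[of U] linear_sigma_minus[of U]
    by (simp_all add: linear_conv_bounded_linear[symmetric] linear_iff)
  ultimately show "is_section G H (R_plus U) (\<lambda>g. sigma_plus U g $ i)"
    and "is_section G H (R_minus U) (\<lambda>g. sigma_minus U g $ i)"
    unfolding is_section_def using smooth_near_bounded_linear by blast+
qed

lemma invertible_in_basis:
  assumes U: "unitary U" and g: "unitary g"
  shows "invertible (in_basis U g)"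
proof -
  have "in_basis U g ** in_basis U (dagger g) = mat 1" "in_basis U (dagger g) ** in_basis U g = mat 1"
    using g U by (simp_all add: unitary_def flip: in_basis_mult[OF U]) (simp_all add: in_basis_def)
  then show ?thesis
    unfolding invertible_def by blast
qed

text \<open>The inner bracket kills the diagonal blocks; on the remaining block of the plus columns
  the outer one multiplies by \<open>r_minus - r_plus\<close>, on that of the minus columns by the
  opposite number. Hence the claim concerns elements of the form
  \<open>lie \<rho> X\<close>.\<close>

lemma sigma_lie_lie:
  fixes U :: "complex^('p::finite + 'm::finite)^'n"
  assumes U: "adapted_basis \<rho> k U" and r: "r_plus - r_minus = \<i>"
    and plus: "\<And>u. u \<in> V_plus \<rho> k \<Longrightarrow> \<rho> *v u = r_plus *s u"
    and minus: "\<And>u. u \<in> V_minus \<rho> k \<Longrightarrow> \<rho> *v u = r_minus *s u"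
  shows "sigma_plus U (g ** lie \<rho> (lie \<rho> X)) = - (\<i> *\<^sub>C sigma_plus U (g ** lie \<rho> X))"
    and "sigma_minus U (g ** lie \<rho> (lie \<rho> X)) = \<i> *\<^sub>C sigma_minus U (g ** lie \<rho> X)"
proof -
  define e :: "'p + 'm \<Rightarrow> complex" where "e = case_sum (\<lambda>_. r_plus) (\<lambda>_. r_minus)"
  have u: "unitary U"
    using U by (simp add: adapted_basis_def)
  have "\<rho> *v column b U = e b *s column b U" for b
    using U by (cases b) (auto simp: adapted_basis_def e_def plus minus)
  note lie_eq = in_basis_lie_diagonal[OF u this]
  have r': "r_minus - r_plus = - \<i>"
    using r by (simp add: algebra_simps)
  have "sigma_plus U (lie \<rho> (lie \<rho> X)) = - (\<i> *\<^sub>C sigma_plus U (lie \<rho> X))"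
    by (auto simp: vec_eq_iff sigma_plus_def cscale_def lie_eq e_def r r' split: sum.split)
  then show "sigma_plus U (g ** lie \<rho> (lie \<rho> X)) = - (\<i> *\<^sub>C sigma_plus U (g ** lie \<rho> X))"
    by (simp add: sigma_mult[OF u] matrix_mult.minus_right cscale_right)
  have "sigma_minus U (lie \<rho> (lie \<rho> X)) = \<i> *\<^sub>C sigma_minus U (lie \<rho> X)"
    by (auto simp: vec_eq_iff sigma_minus_def cscale_def lie_eq e_def r r' split: sum.split)
  then show "sigma_minus U (g ** lie \<rho> (lie \<rho> X)) = \<i> *\<^sub>C sigma_minus U (g ** lie \<rho> X)"
    by (simp add: sigma_mult[OF u] cscale_right)
qed


theorem proposition5p1:
  fixes gC \<gg> t G H :: "(complex^'n^'n) set"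
    and \<Delta> :: "(complex^'n^'n \<Rightarrow> complex) set"
    and \<phi> :: "complex^'n^'n \<Rightarrow> complex"
    and \<rho> :: "complex^'n^'n"
    and J :: "complex^'n^'n \<Rightarrow> complex^'n^'n"
    and P :: "complex^'n^'n \<Rightarrow> (complex^'n^'n \<Rightarrow> real) \<Rightarrow> (complex^'n^'n \<Rightarrow> real) \<Rightarrow> real"
    and k :: real
    and U :: "complex^('p::finite + 'm::finite)^'n"
  assumes "classical gC" and "lie_simple gC"
    and "\<gg> = compact_form gC"
    and "cartan_subalgebra \<gg> t"
    and "simple_system (roots gC t) \<Delta>"
    and "noncompact_simple_root (roots gC t) \<Delta> \<phi>"
    and "G = conn_group \<gg>"
    and "H = conn_group (h_sub gC t \<Delta> \<phi>)"
    and "\<rho> \<in> lie_center (h_sub gC t \<Delta> \<phi>)" and "\<phi> \<rho> = \<i>"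
    and "is_J gC t \<Delta> J"
    and "is_kks \<gg> \<rho> P"
    and "mexp (pi *\<^sub>R \<rho>) ** mexp (pi *\<^sub>R \<rho>) = mat (cis (2 * k))"
    and "adapted_basis \<rho> k U"
  shows
    "(\<forall>i. is_section G H (R_plus U) (\<lambda>g. sigma_plus U g $ i)) \<and>
     (\<forall>i. is_section G H (R_minus U) (\<lambda>g. sigma_minus U g $ i)) \<and>
     (\<forall>g\<in>G. invertible (in_basis U g)) \<and>
     (\<forall>g\<in>G. \<forall>v\<in>tang \<gg> (mu \<rho> g).
        let d\<mu> = orbit_diff \<gg> (\<lambda>x. x) (mu \<rho> g) v in
        nabla_N_rows J \<gg> \<rho> P (in_basis U) g v =
          in_basis U (- J d\<mu> + lie (mu \<rho> g) d\<mu>) ** in_basis U g) \<and>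
     ((case_AIII gC H \<or> case_CI gC H \<or> case_DIII gC H) \<and>
      (\<exists>r_plus r_minus. r_plus - r_minus = \<i> \<and>
         (\<forall>u\<in>V_plus \<rho> k. \<rho> *v u = r_plus *s u) \<and>
         (\<forall>u\<in>V_minus \<rho> k. \<rho> *v u = r_minus *s u)) \<longrightarrow>
      (\<forall>g\<in>G. \<forall>v\<in>tang \<gg> (mu \<rho> g).
         let d\<mu> = orbit_diff \<gg> (\<lambda>x. x) (mu \<rho> g) v in
         nabla_N_rows J \<gg> \<rho> P (sigma_plus U) g v = - (in_basis U (C_plus J d\<mu>) ** sigma_plus U g) \<and>
         nabla_N_rows J \<gg> \<rho> P (sigma_minus U) g v = in_basis U (C_minus J d\<mu>) ** sigma_minus U g))"
proof -
  interpret dagger_lie_algebra gC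
    using assms(1) by (rule classical_dagger_lie_algebra)
  interpret hermitian_root_data gC t \<Delta> \<phi> \<rho> J
    by unfold_locales (use assms in \<open>auto intro: classical_Ad_closed\<close>)
  note gg = \<open>\<gg> = compact_form gC\<close>
  have U: "unitary U" "adapted_basis \<rho> k U"
    using assms(14) by (simp_all add: adapted_basis_def)
  have P: "is_kks (compact_form gC) \<rho> P"
    using assms(12) by (simp add: gg)
  have G: "G = conn_group (compact_form gC)"
    using assms(7) by (simp add: gg)
  have rows: "nabla_N_rows J \<gg> \<rho> P F g v = F ((lie (mu \<rho> g) v - J v) ** g)"
    if "linear F" "g \<in> G" "v \<in> tang \<gg> (mu \<rho> g)" for F :: "complex^'n^'n \<Rightarrow> complex^'k^'r" and g v
    using nabla_N_rows_linear[OF P _ _ that(1), of g v] that by (simp add: gg G)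
  \<comment> \<open>The one-form is the differential of the inclusion of the orbit, so it returns
    the tangent vector.\<close>
  have d\<mu>: "orbit_diff \<gg> (\<lambda>x. x) x v = v" if "v \<in> tang \<gg> x" for x v
  proof -
    have "frechet_derivative (\<lambda>x. x) (at x) = (\<lambda>v. v)"
      using frechet_derivative_at[OF has_derivative_ident] by metis
    then show ?thesis
      using that by (simp add: orbit_diff_def)
  qed
  have g_unitary: "unitary g" if "g \<in> G" for g
    using that G_unitary by (simp add: G)
  have sections: "is_section G H (R_plus U) (\<lambda>g. sigma_plus U g $ i)"
    "is_section G H (R_minus U) (\<lambda>g. sigma_minus U g $ j)" for i j
    using center_commutes_mexp[OF assms(9)] assms(8) by (auto intro!: sigma_sections[OF U(2)])
  have fundamental: "nabla_N_rows J \<gg> \<rho> P (in_basis U) g v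
      = in_basis U (- J v + lie (mu \<rho> g) v) ** in_basis U g"
    if "g \<in> G" "v \<in> tang \<gg> (mu \<rho> g)" for g v
    using that by (simp add: rows linear_in_basis flip: in_basis_mult[OF U(1)])
  have eigenbundles: "nabla_N_rows J \<gg> \<rho> P (sigma_plus U) g v = - (in_basis U (C_plus J v) ** sigma_plus U g)"
    "nabla_N_rows J \<gg> \<rho> P (sigma_minus U) g v = in_basis U (C_minus J v) ** sigma_minus U g"
    if r: "r_plus - r_minus = \<i>" "\<And>u. u \<in> V_plus \<rho> k \<Longrightarrow> \<rho> *v u = r_plus *s u"
        "\<And>u. u \<in> V_minus \<rho> k \<Longrightarrow> \<rho> *v u = r_minus *s u"
      and g: "g \<in> G" and v: "v \<in> tang \<gg> (mu \<rho> g)" for r_plus r_minus g v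
  proof -
    note u = g_unitary[OF g]
    obtain X where X: "v = lie X (mu \<rho> g)"
      using v by (auto simp: tang_def)
    define Y where "Y = - Ad (dagger g) X"
    have Y: "Ad (dagger g) v = lie \<rho> Y"
      using Ad_lie[OF unitary_dagger[OF u]] Ad_dagger_cancel[OF u]
      by (simp add: X mu_Ad Y_def lie_simps lie_anticomm[of \<rho>])
    \<comment> \<open>Carries the computation to the base point, where \<open>mu \<rho> g\<close>
      becomes \<open>\<rho>\<close>.\<close>
    have slide: "Z ** g = g ** Ad (dagger g) Z" for Z
      using u by (simp add: Ad_unitary unitary_dagger matrix_mul_assoc) (simp add: unitary_def)
    have vg: "v ** g = g ** lie \<rho> Y"
      by (simp add: slide Y)
    have "lie (mu \<rho> g) v ** g = g ** lie \<rho> (lie \<rho> Y)"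
      using Ad_lie[OF unitary_dagger[OF u]] Ad_dagger_cancel[OF u] by (simp add: slide Y mu_Ad)
    \<comment> \<open>Combined with the summand \<open>- J v\<close>, the two scalars complete
      \<open>- C_plus J v\<close> and \<open>C_minus J v\<close>.\<close>
    then have plus: "sigma_plus U (lie (mu \<rho> g) v ** g) = - (\<i> *\<^sub>C sigma_plus U (v ** g))"
      and minus: "sigma_minus U (lie (mu \<rho> g) v ** g) = \<i> *\<^sub>C sigma_minus U (v ** g)"
      using sigma_lie_lie[OF U(2) r, of g Y] by (simp_all add: vg)
    have i: "in_basis U (\<i> *\<^sub>C v) = \<i> *\<^sub>C in_basis U v"
      by (simp add: in_basis_def cscale_left cscale_right)
    show "nabla_N_rows J \<gg> \<rho> P (sigma_plus U) g v = - (in_basis U (C_plus J v) ** sigma_plus U g)"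
      using plus
      by (simp add: rows[OF linear_sigma_plus g v] matrix_mult.diff_left linear_diff[OF linear_sigma_plus]
          sigma_mult[OF U(1)] C_plus_def linear_add[OF linear_in_basis] i matrix_mult.add_left cscale_left)
    show "nabla_N_rows J \<gg> \<rho> P (sigma_minus U) g v = in_basis U (C_minus J v) ** sigma_minus U g"
      using minus
      by (simp add: rows[OF linear_sigma_minus g v] matrix_mult.diff_left linear_diff[OF linear_sigma_minus]
          sigma_mult[OF U(1)] C_minus_def linear_diff[OF linear_in_basis] i cscale_left)
  qed
  show ?thesis
    unfolding Let_def
    using sections invertible_in_basis[OF U(1) g_unitary] fundamental eigenbundles by (auto simp: d\<mu>)
qed

end
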